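(* For each $\alpha\in\mathbb{R}$ let $F_\alpha\subset\mathbb{T}$ be a set that does not contain $(1,0)$ or $(-1,0)$, and suppose that $$\{(\alpha,t)\in\mathbb{R}^2:(\cos t,\sin t)\in F_\alpha\}$$ is (Lebesgue) measurable. Suppose $y^-<0<y^+$ are real numbers, and suppose $U\subset\mathbb{R}^2$ is an open set containing the horizontal lines $\{(x,y^-):x\in\mathbb{R}\}$ and $\{(x,y^+):x\in\mathbb{R}\}$. Then there exists a set $E\subset U$ such that $$P_{(\alpha,0)}(E)\supset F_\alpha\qquad\text{and}\qquad|P_{(\alpha,0)}(E)\setminus F_\alpha|=0$$ for almost every $\alpha\in\mathbb{R}$.
   Context: $\mathbb{T}$ denotes the unit circle in $\mathbb{R}^2$, and $|\cdot|$ of a subset of $\mathbb{T}$ is its arc-length (Lebesgue) measure. For $a\in\mathbb{R}^2$, the radial projection to $a$ is the map $P_a:\mathbb{R}^2\setminus\{a\}\to\mathbb{T}$, $P_a(x)=\frac{x-a}{\|x-a\|}$; for a set $E$, $P_a(E)$ means $P_a(E\setminus\{a\})$. *)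

theory Defs
  imports "HOL-Analysis.Analysis"
begin

text \<open>The plane is \<^typ>\<open>real \<times> real\<close>, whose norm in HOL-Analysis is the Euclidean one.\<close>

definition unit_circle :: "(real \<times> real) set" where
  "unit_circle = sphere 0 1"

text \<open>Arc length as push-forward of Lebesgue measure under the standard parametrisation of the
  circle. It is completed, so its null sets are all subsets of Borel sets of length zero; a set
  has length zero if it belongs to \<open>null_sets arc_length\<close> (the value of \<^const>\<open>emeasure\<close> being 0
  would not suffice, since it is also 0 on non-measurable sets).\<close>

definition arc_length :: "(real \<times> real) measure" where
  "arc_length =
     completion (distr (restrict_space lborel {0..<2 * pi}) (restrict_space borel unit_circle)
       (\<lambda>t. (cos t, sin t)))"

definition radial_point :: "real \<times> real \<Rightarrow> real \<times> real \<Rightarrow> real \<times> real" where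
  "radial_point a x = (x - a) /\<^sub>R norm (x - a)"

definition radial_proj :: "real \<times> real \<Rightarrow> (real \<times> real) set \<Rightarrow> (real \<times> real) set" where
  "radial_proj a E = radial_point a ` (E - {a})"

end

theory Submission
  imports Defs
begin

text \<open>In the coordinates \<open>(u, v) = (x / y, 1 / y)\<close> on the upper half-plane, the point \<open>(x, y)\<close> is seen
  from \<open>(\<alpha>, 0)\<close> in the direction of \<open>(s, 1)\<close> with \<open>s = u - \<alpha> v\<close>, so radial projections become the
  linear projections \<open>pr \<alpha>\<close>; the lower half-plane is treated in the same way. A point of the
  \<open>(u, v)\<close>-plane corresponds to a line in the \<open>(\<alpha>, s)\<close>-plane, and the claim becomes Davies' theorem:
  every measurable set in the \<open>(\<alpha>, s)\<close>-plane can be covered by lines with slopes in a prescribed open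
  range whose union exceeds the set by a null set only.

  The engine is an iterated Venetian blind. A segment is replaced by many short parallel ones, each
  starting near the original, in the direction annihilated by \<open>pr \<beta>\<close>; when \<open>\<beta>\<close> is moved in small
  steps away from the interval of parameters to be covered, the slats can keep the same total length,
  while every parameter outside of the interval at some stage sees all slats nearly end-on.
  The measurable set is enclosed in open sets \<open>G k\<close>; each stage cuts the covered part of \<open>G k\<close>
  into small cells contained in \<open>G k\<close> and replaces the segment of each cell by such a blind inside a
  compact neighbourhood of it. Nested compact sets then still meet every line that has to be met.\<close>

section \<open>Projections and Venetian blinds\<close>

definition pr :: "real \<Rightarrow> real \<times> real \<Rightarrow> real" where
  "pr \<alpha> z = fst z - \<alpha> * snd z"

text \<open>The union of the lines dual to the points of \<open>E\<close>.\<close>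

definition shadow :: "(real \<times> real) set \<Rightarrow> (real \<times> real) set" where
  "shadow E = {(\<alpha>, s). s \<in> pr \<alpha> ` E}"

text \<open>A segment is given by its midpoint and a half-vector, so that its projection is an
  interval with centre \<open>pr \<alpha> x\<close> and radius
  \<open>\<bar>pr \<alpha> v\<bar>\<close> whatever the sign of
  \<open>pr \<alpha> v\<close>.\<close>

definition seg :: "real \<times> real \<Rightarrow> real \<times> real \<Rightarrow> (real \<times> real) set" where
  "seg x v = (\<lambda>t. x + t *\<^sub>R v) ` {-1..1}"

definition blind :: "(real \<times> real) set \<Rightarrow> real \<times> real \<Rightarrow> (real \<times> real) set" where
  "blind X v = (\<Union>x\<in>X. seg x v)"

text \<open>The Minkowski sum with a closed ball is used because compactness of \<open>K\<close>
  then passes to the neighbourhood at once.\<close>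

definition nbhd :: "(real \<times> real) set \<Rightarrow> real \<Rightarrow> (real \<times> real) set" where
  "nbhd K \<delta> = {x + y |x y. x \<in> K \<and> y \<in> cball 0 \<delta>}"

section \<open>Elementary facts on projections, segments and neighbourhoods\<close>

lemma mem_seg: "z \<in> seg x v \<longleftrightarrow> (\<exists>t. \<bar>t\<bar> \<le> 1 \<and> z = x + t *\<^sub>R v)"
  unfolding seg_def by (auto simp: abs_le_iff image_iff)

lemma pr_add: "pr \<alpha> (x + y) = pr \<alpha> x + pr \<alpha> y"
  and pr_scaleR: "pr \<alpha> (c *\<^sub>R x) = c * pr \<alpha> x"
  by (auto simp: pr_def algebra_simps)

lemma abs_pr_le: "\<bar>pr \<alpha> z\<bar> \<le> (1 + \<bar>\<alpha>\<bar>) * norm z"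
proof -
  have f: "\<bar>fst z\<bar> \<le> norm z" "\<bar>snd z\<bar> \<le> norm z"
    using norm_fst_le[of "fst z" "snd z"] norm_snd_le[of "snd z" "fst z"] by auto
  have "\<bar>pr \<alpha> z\<bar> \<le> \<bar>fst z\<bar> + \<bar>\<alpha>\<bar> * \<bar>snd z\<bar>"
    unfolding pr_def abs_mult[symmetric] by (rule abs_triangle_ineq4)
  also have "\<dots> \<le> norm z + \<bar>\<alpha>\<bar> * norm z"
    using f by (intro add_mono mult_left_mono) auto
  finally show ?thesis by (simp add: algebra_simps)
qed

lemma continuous_on_pr [continuous_intros]: "continuous_on S (pr \<alpha>)"
  unfolding pr_def by (intro continuous_intros)

lemma compact_seg: "compact (seg x v)"
  unfolding seg_def by (intro compact_continuous_image continuous_intros) auto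

lemma compact_blind: "finite X \<Longrightarrow> compact (blind X v)"
  unfolding blind_def by (intro compact_UN compact_seg)

lemma compact_nbhd: "compact K \<Longrightarrow> compact (nbhd K \<delta>)"
  unfolding nbhd_def by (intro compact_sums compact_cball)

lemma nbhd_mono: "K \<subseteq> L \<Longrightarrow> \<delta> \<le> \<epsilon> \<Longrightarrow> nbhd K \<delta> \<subseteq> nbhd L \<epsilon>"
  unfolding nbhd_def by force

lemma subset_nbhd: "0 \<le> \<delta> \<Longrightarrow> K \<subseteq> nbhd K \<delta>"
  unfolding nbhd_def by force

lemma nbhd_subset_nbhd:
  assumes "\<And>k. k \<in> K \<Longrightarrow> \<exists>l\<in>L. norm (k - l) \<le> r" and "\<delta> + r \<le> \<epsilon>"
  shows "nbhd K \<delta> \<subseteq> nbhd L \<epsilon>"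
proof
  fix z assume "z \<in> nbhd K \<delta>"
  then obtain k y where z: "z = k + y" "k \<in> K" "norm y \<le> \<delta>"
    by (auto simp: nbhd_def)
  obtain l where l: "l \<in> L" "norm (k - l) \<le> r" using assms(1) z(2) by blast
  have "norm ((k - l) + y) \<le> \<epsilon>"
    using norm_triangle_ineq[of "k - l" y] l(2) z(3) assms(2) by linarith
  moreover have "z = l + ((k - l) + y)" using z(1) by simp
  ultimately show "z \<in> nbhd L \<epsilon>"
    using l(1) unfolding nbhd_def by fastforce
qed

lemma shadow_mono: "E \<subseteq> E' \<Longrightarrow> shadow E \<subseteq> shadow E'"
  unfolding shadow_def by blast

text \<open>The relation between a point and the points of its dual line is closed, and projecting
  away a compact factor keeps it closed. So shadows of compact sets are Borel.\<close>

lemma closed_shadow: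
  assumes "compact K" shows "closed (shadow K)"
proof -
  have "closed {(z, p). snd p = pr (fst p) z}"
    unfolding pr_def case_prod_unfold by (intro closed_Collect_eq continuous_intros)
  from closed_compact_projection[OF assms this]
  show ?thesis unfolding shadow_def by (rule back_subst[where P = closed]) force
qed

lemma pr_seg: "pr \<alpha> ` seg x v = cball (pr \<alpha> x) \<bar>pr \<alpha> v\<bar>"
proof (intro equalityI subsetI)
  fix s assume "s \<in> pr \<alpha> ` seg x v"
  then obtain t where t: "\<bar>t\<bar> \<le> 1" "s = pr \<alpha> (x + t *\<^sub>R v)"
    by (metis imageE mem_seg)
  then have "\<bar>t\<bar> \<le> 1" "s = pr \<alpha> x + t * pr \<alpha> v"
    by (auto simp: pr_add pr_scaleR)
  then show "s \<in> cball (pr \<alpha> x) \<bar>pr \<alpha> v\<bar>"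
    using mult_right_mono[of "\<bar>t\<bar>" 1 "\<bar>pr \<alpha> v\<bar>"] by (simp add: dist_real_def abs_mult)
next
  fix s assume s: "s \<in> cball (pr \<alpha> x) \<bar>pr \<alpha> v\<bar>"
  show "s \<in> pr \<alpha> ` seg x v"
  proof (cases "pr \<alpha> v = 0")
    case True
    then have "s = pr \<alpha> x" using s by simp
    moreover have "x \<in> seg x v" unfolding seg_def by (rule image_eqI[where x = 0]) auto
    ultimately show ?thesis by blast
  next
    case False
    define t where "t = (s - pr \<alpha> x) / pr \<alpha> v"
    have "\<bar>t\<bar> \<le> 1" using s False by (simp add: t_def dist_real_def divide_le_eq)
    moreover have "s = pr \<alpha> (x + t *\<^sub>R v)" using False by (simp add: pr_add pr_scaleR t_def)
    ultimately show ?thesis using mem_seg by blast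
  qed
qed

lemma pr_nbhd_seg:
  assumes "0 \<le> \<delta>"
  shows "pr \<alpha> ` nbhd (seg x v) \<delta> \<subseteq> cball (pr \<alpha> x) (\<bar>pr \<alpha> v\<bar> + (1 + \<bar>\<alpha>\<bar>) * \<delta>)"
proof clarify
  fix z1 z2 assume "(z1, z2) \<in> nbhd (seg x v) \<delta>"
  then obtain k y where z: "(z1, z2) = k + y" "k \<in> seg x v" "norm y \<le> \<delta>"
    unfolding nbhd_def by (smt (verit) mem_Collect_eq mem_cball_0)
  have "\<bar>pr \<alpha> x - pr \<alpha> k\<bar> \<le> \<bar>pr \<alpha> v\<bar>"
    using pr_seg[of \<alpha> x v] z(2) by (auto simp: dist_real_def set_eq_iff image_iff)
  moreover have "\<bar>pr \<alpha> y\<bar> \<le> (1 + \<bar>\<alpha>\<bar>) * \<delta>"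
    using abs_pr_le[of \<alpha> y] mult_left_mono[OF z(3), of "1 + \<bar>\<alpha>\<bar>"] by linarith
  ultimately show "pr \<alpha> (z1, z2) \<in> cball (pr \<alpha> x) (\<bar>pr \<alpha> v\<bar> + (1 + \<bar>\<alpha>\<bar>) * \<delta>)"
    unfolding z(1) by (simp add: dist_real_def pr_add)
qed

lemma nbhd_blind: "nbhd (blind X v) \<delta> = (\<Union>x\<in>X. nbhd (seg x v) \<delta>)"
  unfolding nbhd_def blind_def by blast

text \<open>Overlaps of the slats are ignored: the number of slats times the length of one projected
  slat is already small enough in the sweep.\<close>

lemma emeasure_pr_nbhd_blind:
  assumes "finite X" "0 \<le> \<delta>"
  shows "emeasure lborel (pr \<alpha> ` nbhd (blind X v) \<delta>)
    \<le> ennreal (card X * (2 * (\<bar>pr \<alpha> v\<bar> + (1 + \<bar>\<alpha>\<bar>) * \<delta>)))"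
proof -
  define r where "r = \<bar>pr \<alpha> v\<bar> + (1 + \<bar>\<alpha>\<bar>) * \<delta>"
  have r: "0 \<le> r" using assms(2) by (simp add: r_def)
  have "emeasure lborel (pr \<alpha> ` nbhd (blind X v) \<delta>) \<le> emeasure lborel (\<Union>x\<in>X. cball (pr \<alpha> x) r)"
  proof (rule emeasure_mono)
    show "pr \<alpha> ` nbhd (blind X v) \<delta> \<subseteq> (\<Union>x\<in>X. cball (pr \<alpha> x) r)"
      unfolding nbhd_blind image_UN r_def by (intro UN_mono order_refl pr_nbhd_seg assms(2))
    show "(\<Union>x\<in>X. cball (pr \<alpha> x) r) \<in> sets lborel" using assms(1) by auto
  qed
  also have "\<dots> \<le> (\<Sum>x\<in>X. emeasure lborel (cball (pr \<alpha> x) r))"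
    by (intro emeasure_subadditive_finite assms(1)) auto
  also have "\<dots> = (\<Sum>x\<in>X. ennreal (2 * r))"
    using r by (intro sum.cong refl) (simp add: cball_eq_atLeastAtMost)
  also have "\<dots> = ennreal (card X * (2 * r))"
    using r by (simp add: ennreal_mult' ennreal_of_nat_eq_real_of_nat)
  finally show ?thesis unfolding r_def .
qed

text \<open>Midpoints of the \<open>N\<close> equal parts of the interval \<open>[-1, 1]\<close>.\<close>

definition mid :: "nat \<Rightarrow> nat \<Rightarrow> real" where
  "mid N j = (2 * real j + 1) / real N - 1"

lemma abs_mid_le: "j < N \<Longrightarrow> \<bar>mid N j\<bar> \<le> 1 - 1 / N"
  unfolding mid_def by (auto simp: abs_le_iff field_simps)

lemma mid_near:
  assumes "0 < N" "\<bar>t\<bar> \<le> 1"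
  obtains j where "j < N" "\<bar>t - mid N j\<bar> \<le> 1 / N"
proof (cases "t = 1")
  case True
  show ?thesis
    using assms(1) True by (intro that[of "N - 1"]) (auto simp: mid_def of_nat_diff field_simps)
next
  case False
  \<comment> \<open>The endpoint \<open>t = 1\<close> is excluded here because the floor would give
    the index \<open>N\<close>, one too many.\<close>
  define j where "j = nat \<lfloor>(t + 1) * N / 2\<rfloor>"
  have *: "0 \<le> (t + 1) * N / 2" using assms by simp
  have j: "real j \<le> (t + 1) * N / 2" "(t + 1) * N / 2 < real j + 1"
    unfolding j_def using * by linarith+
  have "(t + 1) * N / 2 < N"
    using assms False by (simp add: field_simps)
  then have "j < N" using j(1) by linarith
  moreover have "\<bar>t - mid N j\<bar> \<le> 1 / N"
    unfolding mid_def using j assms(1) by (simp add: abs_le_iff field_simps)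
  ultimately show ?thesis by (rule that)
qed

section \<open>Cutting segments into equal parts and turning the parts about their midpoints\<close>

definition slats :: "nat \<Rightarrow> (real \<times> real) set \<Rightarrow> real \<times> real \<Rightarrow> (real \<times> real) set" where
  "slats N X v = (\<lambda>(x, j). x + mid N j *\<^sub>R v) ` (X \<times> {..<N})"

lemma finite_slats: "finite X \<Longrightarrow> finite (slats N X v)"
  by (simp add: slats_def)

lemma card_slats: "finite X \<Longrightarrow> card (slats N X v) \<le> card X * N"
  unfolding slats_def
  by (rule card_image_le[THEN order_trans]) (auto simp: card_cartesian_product)

lemma seg_subset_slats:
  assumes "0 < N" "x \<in> X"
  shows "seg x v \<subseteq> blind (slats N X v) ((1 / N) *\<^sub>R v)"
proof
  fix z assume "z \<in> seg x v"
  then obtain t where t: "\<bar>t\<bar> \<le> 1" "z = x + t *\<^sub>R v" unfolding mem_seg by blast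
  obtain j where j: "j < N" "\<bar>t - mid N j\<bar> \<le> 1 / N" using mid_near[OF assms(1) t(1)] .
  have "z \<in> seg (x + mid N j *\<^sub>R v) ((1 / N) *\<^sub>R v)"
    unfolding seg_def
  proof (rule image_eqI)
    show "z = x + mid N j *\<^sub>R v + ((t - mid N j) * N) *\<^sub>R (1 / N) *\<^sub>R v"
      using assms(1) t(2) by (simp add: algebra_simps)
    have "\<bar>(t - mid N j) * N\<bar> \<le> 1"
      using j(2) assms(1) unfolding abs_mult by (simp add: pos_le_divide_eq)
    then show "(t - mid N j) * real N \<in> {- 1..1}" by (auto simp: abs_le_iff)
  qed
  then show "z \<in> blind (slats N X v) ((1 / N) *\<^sub>R v)"
    unfolding blind_def slats_def using j(1) assms(2) by force
qed

text \<open>Each segment is first cut into \<open>N\<close> parts in its own direction; then every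
  part is exchanged for a slat with the same midpoint. Nothing is lost at those parameters where the
  new direction projects to at least the same length.\<close>

lemma blind_slats_cover:
  assumes "0 < N" "\<bar>pr \<alpha> v\<bar> \<le> \<bar>pr \<alpha> w\<bar>"
  shows "pr \<alpha> ` blind X v \<subseteq> pr \<alpha> ` blind (slats N X v) ((1 / N) *\<^sub>R w)"
proof -
  have "pr \<alpha> ` blind X v \<subseteq> pr \<alpha> ` blind (slats N X v) ((1 / N) *\<^sub>R v)"
    using seg_subset_slats[OF assms(1)] unfolding blind_def[of X] by (intro image_mono) blast
  also have "\<dots> \<subseteq> pr \<alpha> ` blind (slats N X v) ((1 / N) *\<^sub>R w)"
    unfolding blind_def image_UN pr_seg using assms
    by (intro UN_mono subset_cball order_refl) (auto simp: pr_scaleR abs_mult divide_simps)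
  finally show ?thesis .
qed

lemma slats_subset: "slats N X v \<subseteq> blind X v"
proof -
  have "\<bar>mid N j\<bar> \<le> 1" if "j < N" for j
    using abs_mid_le[OF that] by (rule order_trans) simp
  then show ?thesis unfolding slats_def blind_def mem_seg subset_iff by (auto simp: mem_seg)
qed

text \<open>The midpoints lie on the old segments, so a new slat departs from them by at most its
  half-length, which cutting finely makes as small as desired.\<close>

lemma nbhd_blind_slats:
  assumes "\<delta> + norm w / N \<le> \<epsilon>"
  shows "nbhd (blind (slats N X v) ((1 / N) *\<^sub>R w)) \<delta> \<subseteq> nbhd (blind X v) \<epsilon>"
proof (rule nbhd_subset_nbhd[OF _ assms])
  fix k assume "k \<in> blind (slats N X v) ((1 / N) *\<^sub>R w)"
  then obtain x t where x: "x \<in> slats N X v" "\<bar>t\<bar> \<le> 1" "k = x + t *\<^sub>R (1 / N) *\<^sub>R w"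
    unfolding blind_def UN_iff mem_seg by blast
  have "norm (k - x) \<le> norm w / N"
    using x(2) mult_right_mono[OF x(2), of "norm w / N"] by (simp add: x(3))
  then show "\<exists>l\<in>blind X v. norm (k - l) \<le> norm w / N"
    using x(1) slats_subset by blast
qed

text \<open>The bound on \<open>card X\<close> is kept in the form \<open>m * N0\<close>, with half-slat \<open>w / N0\<close>, because then
  refining the blind does not change the bound \<open>m * 2 * \<bar>pr \<alpha> w\<bar>\<close> for the projected length.\<close>

lemma sweep_step:
  assumes "finite X" "card X \<le> m * N0" "0 < N0" "0 < \<eta>" "real m * (2 * q) < \<epsilon>" "0 \<le> q" "0 \<le> R"
  obtains X' N \<delta> where "finite X'" "card X' \<le> m * N" "0 < N" "0 < \<delta>"
    "nbhd (blind X' ((1 / N) *\<^sub>R w)) \<delta> \<subseteq> nbhd (blind X v) \<eta>"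
    "\<And>\<alpha>. \<bar>pr \<alpha> v\<bar> \<le> \<bar>pr \<alpha> ((1 / N0) *\<^sub>R w)\<bar> \<Longrightarrow>
      pr \<alpha> ` blind X v \<subseteq> pr \<alpha> ` blind X' ((1 / N) *\<^sub>R w)"
    "\<And>\<alpha>. \<bar>\<alpha>\<bar> \<le> R \<Longrightarrow> \<bar>pr \<alpha> w\<bar> \<le> q \<Longrightarrow>
      emeasure lborel (pr \<alpha> ` nbhd (blind X' ((1 / N) *\<^sub>R w)) \<delta>) \<le> ennreal \<epsilon>"
proof -
  \<comment> \<open>Cutting \<open>N1\<close> times makes the half-slats shorter than
    \<open>\<eta> / 2\<close>; the other half of \<open>\<eta>\<close> is left for
    \<open>\<delta>\<close>.\<close>
  obtain N1 where N1: "norm ((1 / N0) *\<^sub>R w) / (\<eta> / 2) < real N1" using reals_Archimedean2 by blast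
  have "0 \<le> norm ((1 / N0) *\<^sub>R w) / (\<eta> / 2)" using assms(4) by simp
  then have N1_pos: "0 < N1" using N1 by linarith
  define N where "N = N0 * N1"
  have N: "0 < N" using N1_pos assms(3) by (simp add: N_def)
  \<comment> \<open>Thickening up to \<open>m * N\<close> slats by \<open>\<delta>\<close> adds at
    most \<open>\<delta> * (c - 1)\<close> to the projected length, and this must fit into the slack
    \<open>\<epsilon> - m * (2 * q)\<close>. The summand 1 keeps \<open>c\<close> positive when
    \<open>m = 0\<close>.\<close>
  define c where "c = real m * N * (2 * (1 + R)) + 1"
  have c: "c > 0" using assms(7) by (simp add: c_def add_nonneg_pos)
  define \<delta> where "\<delta> = min (\<eta> / 2) ((\<epsilon> - real m * (2 * q)) / c)"
  have \<delta>: "0 < \<delta>" using assms(4,5) c by (simp add: \<delta>_def)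
  have "\<delta> \<le> \<eta> / 2" unfolding \<delta>_def by (rule min.cobounded1)
  have "\<delta> \<le> (\<epsilon> - real m * (2 * q)) / c" by (simp add: \<delta>_def)
  then have \<delta>c: "\<delta> * c \<le> \<epsilon> - real m * (2 * q)" using c by (simp add: pos_le_divide_eq)
  define X' where "X' = slats N1 X v"
  have eq: "(1 / N) *\<^sub>R w = (1 / N1) *\<^sub>R (1 / N0) *\<^sub>R w" by (simp add: N_def)
  show ?thesis
  proof (rule that[of X' N \<delta>])
    show "finite X'" using assms(1) by (simp add: X'_def finite_slats)
    have "card X' \<le> card X * N1" unfolding X'_def by (rule card_slats[OF assms(1)])
    also have "\<dots> \<le> m * N" unfolding N_def using assms(2) by simp
    finally show card: "card X' \<le> m * N" .
    show "0 < N" "0 < \<delta>" by fact+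
    have "norm ((1 / N0) *\<^sub>R w) / N1 \<le> \<eta> / 2"
      using N1 N1_pos assms(4)
      by (simp only: pos_divide_less_eq pos_divide_le_eq half_gt_zero of_nat_0_less_iff mult.commute)
    then show "nbhd (blind X' ((1 / N) *\<^sub>R w)) \<delta> \<subseteq> nbhd (blind X v) \<eta>"
      unfolding X'_def eq using \<open>\<delta> \<le> \<eta> / 2\<close> by (intro nbhd_blind_slats) linarith
    show "pr \<alpha> ` blind X v \<subseteq> pr \<alpha> ` blind X' ((1 / N) *\<^sub>R w)"
      if "\<bar>pr \<alpha> v\<bar> \<le> \<bar>pr \<alpha> ((1 / N0) *\<^sub>R w)\<bar>" for \<alpha>
      unfolding X'_def eq by (rule blind_slats_cover[OF N1_pos that])
    fix \<alpha> assume \<alpha>: "\<bar>\<alpha>\<bar> \<le> R" "\<bar>pr \<alpha> w\<bar> \<le> q"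
    have "\<bar>pr \<alpha> ((1 / N) *\<^sub>R w)\<bar> \<le> q / N"
      using \<alpha>(2) N by (simp add: pr_scaleR abs_mult divide_right_mono)
    moreover have "(1 + \<bar>\<alpha>\<bar>) * \<delta> \<le> (1 + R) * \<delta>"
      using \<alpha> \<delta> by (intro mult_right_mono) auto
    ultimately have "card X' * (2 * (\<bar>pr \<alpha> ((1 / N) *\<^sub>R w)\<bar> + (1 + \<bar>\<alpha>\<bar>) * \<delta>))
      \<le> real (m * N) * (2 * (q / N + (1 + R) * \<delta>))"
      using card \<delta> \<alpha> assms(6,7)
      by (intro mult_mono add_mono) (auto simp: of_nat_le_iff simp del: of_nat_mult)
    also have "\<dots> = real m * (2 * q) + \<delta> * (c - 1)"
      using N by (simp add: c_def field_simps)
    also have "\<dots> \<le> \<epsilon>" using \<delta>c \<delta> by (simp add: algebra_simps)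
    finally show "emeasure lborel (pr \<alpha> ` nbhd (blind X' ((1 / N) *\<^sub>R w)) \<delta>) \<le> ennreal \<epsilon>"
      using emeasure_pr_nbhd_blind[OF \<open>finite X'\<close>, of \<delta> \<alpha>] \<delta>
      by (meson ennreal_leI less_imp_le order_trans)
  qed
qed

lemma emeasure_pr_mono:
  assumes "A \<subseteq> B" "compact B"
  shows "emeasure lborel (pr \<alpha> ` A) \<le> emeasure lborel (pr \<alpha> ` B)"
proof (rule emeasure_mono)
  have "compact (pr \<alpha> ` B)" by (intro compact_continuous_image continuous_intros assms)
  then show "pr \<alpha> ` B \<in> sets lborel" by (simp add: borel_compact)
qed (use assms in blast)

text \<open>The directions are \<open>w i\<close>, annihilated by \<open>pr \<beta>'\<close> at \<open>\<beta>' = \<sigma> * (\<beta> + i * h)\<close>. As these parameters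
  move away from \<open>\<sigma> * \<alpha> \<le> b\<close>, the projections of \<open>w i\<close> there only grow, so a single factor \<open>\<mu>\<close> serves for
  all \<open>i\<close>, and the step size \<open>h\<close> can be chosen after it.\<close>

lemma sweep:
  assumes "finite X" "\<sigma> = 1 \<or> \<sigma> = -1" "b < \<beta>" "0 < \<epsilon>" "0 < \<eta>" "0 \<le> R"
  obtains X' v' \<delta> where "finite X'" "0 < \<delta>" "nbhd (blind X' v') \<delta> \<subseteq> nbhd (blind X v) \<eta>"
    "\<And>\<alpha>. \<bar>\<alpha>\<bar> \<le> R \<Longrightarrow> \<sigma> * \<alpha> \<le> b \<Longrightarrow> pr \<alpha> ` blind X v \<subseteq> pr \<alpha> ` blind X' v'"
    "\<And>\<alpha>. \<bar>\<alpha>\<bar> \<le> R \<Longrightarrow> \<beta> \<le> \<sigma> * \<alpha> \<Longrightarrow>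
      emeasure lborel (pr \<alpha> ` nbhd (blind X' v') \<delta>) \<le> ennreal \<epsilon>"
proof -
  have \<sigma>: "\<sigma> * \<sigma> = 1" using assms(2) by auto
  define m where "m = card X"
  \<comment> \<open>For \<open>\<sigma> * \<alpha> \<le> b\<close> the projection of
    \<open>v\<close> is at most \<open>(1 + R) * norm v\<close>, that of \<open>w 0\<close> at least
    \<open>\<mu> * (\<beta> - b)\<close>; this factor makes the second dominate.\<close>
  define \<mu> where "\<mu> = (1 + R) * (norm v + 1) / (\<beta> - b)"
  have \<mu>: "0 < \<mu>" using assms by (simp add: \<mu>_def add_pos_nonneg add_nonneg_pos)
  \<comment> \<open>Within distance \<open>h\<close> of the parameter that annihilates
    \<open>w i\<close>, this vector projects to at most \<open>q = \<mu> * h\<close>. The step is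
    chosen so that the total \<open>m * (2 * q)\<close> stays below
    \<open>\<epsilon>\<close>.\<close>
  define h where "h = \<epsilon> / (4 * (real m + 1) * \<mu>)"
  have h: "0 < h" using assms \<mu> by (simp add: h_def)
  define q where "q = \<mu> * h"
  have q0: "0 \<le> q" using \<mu> h by (simp add: q_def)
  have "real m * (2 * q) = (real m / (real m + 1)) * (\<epsilon> / 2)"
    using \<mu> by (simp add: q_def h_def divide_simps)
  also have "\<dots> < 1 * \<epsilon>" using assms by (intro mult_strict_mono) (auto simp: field_simps)
  finally have q: "real m * (2 * q) < \<epsilon>" by simp
  define w where "w i = (\<mu> * (\<sigma> * (\<beta> + real i * h)), \<mu>)" for i :: nat
  have prw: "\<bar>pr \<alpha> (w i)\<bar> = \<mu> * \<bar>\<beta> + real i * h - \<sigma> * \<alpha>\<bar>" for \<alpha> i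
  proof -
    have "pr \<alpha> (w i) = \<sigma> * (\<mu> * (\<beta> + real i * h - \<sigma> * \<alpha>))"
      using \<sigma> by (simp add: pr_def w_def algebra_simps)
    then show ?thesis using \<mu> assms(2) by (auto simp: abs_mult)
  qed
  have ex: "\<exists>X' N \<delta>. finite X' \<and> card X' \<le> m * N \<and> 0 < N \<and> 0 < \<delta> \<and>
      nbhd (blind X' ((1 / real N) *\<^sub>R w i)) \<delta> \<subseteq> nbhd (blind X v) \<eta> \<and>
      (\<forall>\<alpha>. \<bar>\<alpha>\<bar> \<le> R \<longrightarrow> \<sigma> * \<alpha> \<le> b \<longrightarrow> pr \<alpha> ` blind X v \<subseteq> pr \<alpha> ` blind X' ((1 / real N) *\<^sub>R w i)) \<and>
      (\<forall>\<alpha>. \<bar>\<alpha>\<bar> \<le> R \<longrightarrow> \<beta> \<le> \<sigma> * \<alpha> \<longrightarrow> \<sigma> * \<alpha> \<le> \<beta> + real i * h \<longrightarrow>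
        emeasure lborel (pr \<alpha> ` nbhd (blind X' ((1 / real N) *\<^sub>R w i)) \<delta>) \<le> ennreal \<epsilon>)" for i
  proof (induction i)
    \<comment> \<open>The initial segments count as uncut, \<open>N0 = 1\<close>: their direction is
      changed from \<open>v\<close> to \<open>w 0\<close> in the first step.\<close>
    case 0
    have card: "card X \<le> m * 1" by (simp add: m_def)
    from sweep_step[OF assms(1) card _ assms(5) q q0 assms(6), of "w 0" v]
    obtain X' N \<delta> where *: "finite X'" "card X' \<le> m * N" "0 < N" "0 < \<delta>"
      "nbhd (blind X' ((1 / real N) *\<^sub>R w 0)) \<delta> \<subseteq> nbhd (blind X v) \<eta>"
      "\<And>\<alpha>. \<bar>pr \<alpha> v\<bar> \<le> \<bar>pr \<alpha> ((1 / real 1) *\<^sub>R w 0)\<bar> \<Longrightarrow>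
        pr \<alpha> ` blind X v \<subseteq> pr \<alpha> ` blind X' ((1 / real N) *\<^sub>R w 0)"
      "\<And>\<alpha>. \<bar>\<alpha>\<bar> \<le> R \<Longrightarrow> \<bar>pr \<alpha> (w 0)\<bar> \<le> q \<Longrightarrow>
        emeasure lborel (pr \<alpha> ` nbhd (blind X' ((1 / real N) *\<^sub>R w 0)) \<delta>) \<le> ennreal \<epsilon>"
      by (metis zero_less_one)
    have cov: "\<bar>pr \<alpha> v\<bar> \<le> \<bar>pr \<alpha> ((1 / real 1) *\<^sub>R w 0)\<bar>" if "\<bar>\<alpha>\<bar> \<le> R" "\<sigma> * \<alpha> \<le> b" for \<alpha>
    proof -
      have "\<bar>pr \<alpha> v\<bar> \<le> (1 + \<bar>\<alpha>\<bar>) * norm v" by (rule abs_pr_le)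
      also have "\<dots> \<le> (1 + R) * (norm v + 1)" using that assms(6) by (intro mult_mono) auto
      also have "\<dots> = \<mu> * (\<beta> - b)" using assms(3) by (simp add: \<mu>_def)
      also have "\<dots> \<le> \<mu> * \<bar>\<beta> + real 0 * h - \<sigma> * \<alpha>\<bar>"
        using that \<mu> by (intro mult_left_mono) auto
      finally show ?thesis using prw[of \<alpha> 0] by simp
    qed
    have "\<bar>pr \<alpha> (w 0)\<bar> \<le> q" if "\<beta> \<le> \<sigma> * \<alpha>" "\<sigma> * \<alpha> \<le> \<beta> + real 0 * h" for \<alpha>
      using that q0 by (simp add: prw)
    then show ?case using * cov by blast
  next
    case (Suc i)
    then obtain Y N \<delta> where Y: "finite Y" "card Y \<le> m * N" "0 < N" "0 < \<delta>"
      "nbhd (blind Y ((1 / real N) *\<^sub>R w i)) \<delta> \<subseteq> nbhd (blind X v) \<eta>"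
      "\<And>\<alpha>. \<bar>\<alpha>\<bar> \<le> R \<Longrightarrow> \<sigma> * \<alpha> \<le> b \<Longrightarrow> pr \<alpha> ` blind X v \<subseteq> pr \<alpha> ` blind Y ((1 / real N) *\<^sub>R w i)"
      "\<And>\<alpha>. \<bar>\<alpha>\<bar> \<le> R \<Longrightarrow> \<beta> \<le> \<sigma> * \<alpha> \<Longrightarrow> \<sigma> * \<alpha> \<le> \<beta> + real i * h \<Longrightarrow>
        emeasure lborel (pr \<alpha> ` nbhd (blind Y ((1 / real N) *\<^sub>R w i)) \<delta>) \<le> ennreal \<epsilon>"
      by blast
    obtain X' N' \<delta>' where *: "finite X'" "card X' \<le> m * N'" "0 < N'" "0 < \<delta>'"
      "nbhd (blind X' ((1 / real N') *\<^sub>R w (Suc i))) \<delta>' \<subseteq> nbhd (blind Y ((1 / real N) *\<^sub>R w i)) \<delta>"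
      "\<And>\<alpha>. \<bar>pr \<alpha> ((1 / real N) *\<^sub>R w i)\<bar> \<le> \<bar>pr \<alpha> ((1 / real N) *\<^sub>R w (Suc i))\<bar> \<Longrightarrow>
        pr \<alpha> ` blind Y ((1 / real N) *\<^sub>R w i) \<subseteq> pr \<alpha> ` blind X' ((1 / real N') *\<^sub>R w (Suc i))"
      "\<And>\<alpha>. \<bar>\<alpha>\<bar> \<le> R \<Longrightarrow> \<bar>pr \<alpha> (w (Suc i))\<bar> \<le> q \<Longrightarrow>
        emeasure lborel (pr \<alpha> ` nbhd (blind X' ((1 / real N') *\<^sub>R w (Suc i))) \<delta>') \<le> ennreal \<epsilon>"
      using sweep_step[OF Y(1,2,3,4) q q0 assms(6), of "w (Suc i)" "(1 / real N) *\<^sub>R w i"]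
      by metis
    have cov: "pr \<alpha> ` blind X v \<subseteq> pr \<alpha> ` blind X' ((1 / real N') *\<^sub>R w (Suc i))"
      if "\<bar>\<alpha>\<bar> \<le> R" "\<sigma> * \<alpha> \<le> b" for \<alpha>
    proof -
      have "0 \<le> real i * h" using h by simp
      then have "\<bar>\<beta> + real i * h - \<sigma> * \<alpha>\<bar> \<le> \<bar>\<beta> + real (Suc i) * h - \<sigma> * \<alpha>\<bar>"
        using that(2) assms(3) h unfolding of_nat_Suc distrib_right by linarith
      then have "\<bar>pr \<alpha> (w i)\<bar> \<le> \<bar>pr \<alpha> (w (Suc i))\<bar>"
        unfolding prw using \<mu> by (intro mult_left_mono) auto
      then have "\<bar>pr \<alpha> ((1 / real N) *\<^sub>R w i)\<bar> \<le> \<bar>pr \<alpha> ((1 / real N) *\<^sub>R w (Suc i))\<bar>"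
        unfolding pr_scaleR abs_mult by (intro mult_left_mono) auto
      then show ?thesis using Y(6)[OF that] *(6) by blast
    qed
    have thin: "emeasure lborel (pr \<alpha> ` nbhd (blind X' ((1 / real N') *\<^sub>R w (Suc i))) \<delta>') \<le> ennreal \<epsilon>"
      if \<alpha>: "\<bar>\<alpha>\<bar> \<le> R" "\<beta> \<le> \<sigma> * \<alpha>" "\<sigma> * \<alpha> \<le> \<beta> + real (Suc i) * h" for \<alpha>
    proof (cases "\<sigma> * \<alpha> \<le> \<beta> + real i * h")
      case True
      \<comment> \<open>These parameters were made thin at an earlier stage. They stay thin because
        the new neighbourhood is contained in the previous one.\<close>
      show ?thesis
        by (rule order_trans[OF emeasure_pr_mono[OF *(5)] Y(7)[OF \<alpha>(1,2) True]])
          (intro compact_nbhd compact_blind Y(1))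
    next
      case False
      then have "\<bar>\<beta> + real (Suc i) * h - \<sigma> * \<alpha>\<bar> \<le> h"
        using \<alpha>(3) by (simp add: algebra_simps)
      then have "\<bar>pr \<alpha> (w (Suc i))\<bar> \<le> q"
        unfolding prw q_def using \<mu> by (intro mult_left_mono) auto
      then show ?thesis using *(7)[OF \<alpha>(1)] by blast
    qed
    show ?case using *(1-4) subset_trans[OF *(5) Y(5)] cov thin by blast
  qed
  \<comment> \<open>Finitely many steps carry the annihilated parameter beyond
    \<open>R\<close>.\<close>
  obtain n :: nat where n: "(R - \<beta>) / h < n" using reals_Archimedean2 by blast
  have "\<sigma> * \<alpha> \<le> \<beta> + real n * h" if "\<bar>\<alpha>\<bar> \<le> R" for \<alpha>
  proof -
    have "R - \<beta> < n * h" using n h by (simp add: pos_divide_less_eq)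
    moreover have "\<sigma> * \<alpha> \<le> R" using that assms(2) by auto
    ultimately show ?thesis by linarith
  qed
  with ex[of n] show ?thesis using that by (metis (no_types, lifting))
qed

text \<open>A sweep to the right of \<open>b\<close> is followed by one to the left of
  \<open>a\<close>. The second takes place inside the neighbourhood left by the first, so the
  smallness on the right is inherited.\<close>

lemma two_sided_sweep:
  assumes "finite X" "0 < \<tau>" "0 < \<epsilon>" "0 < \<eta>" "\<bar>a\<bar> \<le> R" "\<bar>b\<bar> \<le> R"
  obtains X' v' \<delta> where "finite X'" "0 < \<delta>" "nbhd (blind X' v') \<delta> \<subseteq> nbhd (blind X v) \<eta>"
    "\<And>\<alpha>. a \<le> \<alpha> \<Longrightarrow> \<alpha> \<le> b \<Longrightarrow> pr \<alpha> ` blind X v \<subseteq> pr \<alpha> ` blind X' v'"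
    "\<And>\<alpha>. \<bar>\<alpha>\<bar> \<le> R \<Longrightarrow> \<alpha> \<le> a - \<tau> \<or> b + \<tau> \<le> \<alpha> \<Longrightarrow>
      emeasure lborel (pr \<alpha> ` nbhd (blind X' v') \<delta>) \<le> ennreal \<epsilon>"
proof -
  have R: "0 \<le> R" using assms(5) by linarith
  have "b < b + \<tau>" "- a < - a + \<tau>" using assms(2) by auto
  obtain Y w \<gamma> where Y: "finite Y" "0 < \<gamma>" "nbhd (blind Y w) \<gamma> \<subseteq> nbhd (blind X v) \<eta>"
    "\<And>\<alpha>. \<bar>\<alpha>\<bar> \<le> R \<Longrightarrow> 1 * \<alpha> \<le> b \<Longrightarrow> pr \<alpha> ` blind X v \<subseteq> pr \<alpha> ` blind Y w"
    "\<And>\<alpha>. \<bar>\<alpha>\<bar> \<le> R \<Longrightarrow> b + \<tau> \<le> 1 * \<alpha> \<Longrightarrow>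
      emeasure lborel (pr \<alpha> ` nbhd (blind Y w) \<gamma>) \<le> ennreal \<epsilon>"
    using sweep[OF assms(1) _ \<open>b < b + \<tau>\<close> assms(3,4) R, of 1 v] by metis
  obtain X' v' \<delta> where X': "finite X'" "0 < \<delta>" "nbhd (blind X' v') \<delta> \<subseteq> nbhd (blind Y w) \<gamma>"
    "\<And>\<alpha>. \<bar>\<alpha>\<bar> \<le> R \<Longrightarrow> -1 * \<alpha> \<le> - a \<Longrightarrow> pr \<alpha> ` blind Y w \<subseteq> pr \<alpha> ` blind X' v'"
    "\<And>\<alpha>. \<bar>\<alpha>\<bar> \<le> R \<Longrightarrow> - a + \<tau> \<le> -1 * \<alpha> \<Longrightarrow>
      emeasure lborel (pr \<alpha> ` nbhd (blind X' v') \<delta>) \<le> ennreal \<epsilon>"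
    using sweep[OF Y(1) _ \<open>- a < - a + \<tau>\<close> assms(3) Y(2) R, of "-1" w] by metis
  show ?thesis
  proof (rule that[of X' \<delta> v'])
    show "nbhd (blind X' v') \<delta> \<subseteq> nbhd (blind X v) \<eta>" using X'(3) Y(3) by blast
    show "pr \<alpha> ` blind X v \<subseteq> pr \<alpha> ` blind X' v'" if "a \<le> \<alpha>" "\<alpha> \<le> b" for \<alpha>
    proof -
      have "\<bar>\<alpha>\<bar> \<le> R" using that assms(5,6) by linarith
      then show ?thesis using Y(4)[of \<alpha>] X'(4)[of \<alpha>] that by auto
    qed
    show "emeasure lborel (pr \<alpha> ` nbhd (blind X' v') \<delta>) \<le> ennreal \<epsilon>"
      if \<alpha>: "\<bar>\<alpha>\<bar> \<le> R" "\<alpha> \<le> a - \<tau> \<or> b + \<tau> \<le> \<alpha>" for \<alpha>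
    proof (cases "\<alpha> \<le> a - \<tau>")
      case True
      then show ?thesis using X'(5)[OF \<alpha>(1)] by simp
    next
      case False
      then have "emeasure lborel (pr \<alpha> ` nbhd (blind Y w) \<gamma>) \<le> ennreal \<epsilon>"
        using Y(5)[OF \<alpha>(1)] \<alpha>(2) by simp
      moreover have "emeasure lborel (pr \<alpha> ` nbhd (blind X' v') \<delta>)
          \<le> emeasure lborel (pr \<alpha> ` nbhd (blind Y w) \<gamma>)"
        by (intro emeasure_pr_mono X'(3) compact_nbhd compact_blind Y(1))
      ultimately show ?thesis by (rule order_trans[rotated])
    qed
  qed (use X' in auto)
qed

section \<open>Cells and their refinement\<close>

text \<open>The part over the parameters in \<open>[a, b]\<close> of the union of the lines dual to
  the points of a segment.\<close>

definition cell :: "real \<times> real \<Rightarrow> real \<times> real \<Rightarrow> real \<Rightarrow> real \<Rightarrow> (real \<times> real) set" where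
  "cell x v a b = {(\<alpha>, s). a \<le> \<alpha> \<and> \<alpha> \<le> b \<and> s \<in> pr \<alpha> ` seg x v}"

definition strip :: "real \<Rightarrow> (real \<times> real) set" where
  "strip R = {(\<alpha>, s). \<bar>\<alpha>\<bar> \<le> R}"

lemma closed_strip: "closed (strip R)"
  unfolding strip_def case_prod_unfold by (intro closed_Collect_le continuous_intros)

lemma closed_cell: "closed (cell x v a b)"
proof -
  have "cell x v a b = {p. a \<le> fst p} \<inter> {p. fst p \<le> b} \<inter> shadow (seg x v)"
    by (auto simp: cell_def shadow_def)
  moreover have "closed \<dots>"
    by (intro closed_Int closed_shadow compact_seg closed_Collect_le continuous_intros)
  ultimately show ?thesis by simp
qed

section \<open>The excess of one refined cell, measured slice by slice\<close>

lemma emeasure_lborel_slices: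
  fixes T :: "(real \<times> real) set"
  assumes "T \<in> sets borel"
  shows "emeasure lborel T = (\<integral>\<^sup>+ \<alpha>. emeasure lborel (Pair \<alpha> -` T) \<partial>lborel)"
proof -
  have "T \<in> sets (lborel \<Otimes>\<^sub>M lborel)"
    using assms unfolding lborel_prod sets_lborel .
  from lborel.emeasure_pair_measure_alt[OF this] show ?thesis unfolding lborel_prod .
qed

lemma emeasure_cball_Diff:
  fixes c r e :: real
  assumes "0 \<le> r" "0 \<le> e"
  shows "emeasure lborel (cball c (r + e) - cball c r) \<le> ennreal (2 * e)"
proof -
  have "emeasure lborel (cball c (r + e) - cball c r)
      \<le> emeasure lborel ({c - r - e..c - r} \<union> {c + r..c + r + e})"
    by (intro emeasure_mono) (auto simp: dist_real_def)
  also have "\<dots> \<le> emeasure lborel {c - r - e..c - r} + emeasure lborel {c + r..c + r + e}"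
    by (intro emeasure_subadditive) auto
  also have "\<dots> = ennreal (2 * e)" using assms by (simp flip: ennreal_plus)
  finally show ?thesis .
qed

text \<open>The excess has three sources, each given a third of \<open>\<epsilon>\<close>. Over
  \<open>[a, b]\<close> the blind stays close to the segment, so only two thin margins appear; away
  from \<open>[a, b]\<close> the sweep makes the whole slice small; in between there are two gaps of
  width \<open>\<tau>\<close>, where a crude bound suffices.\<close>

lemma cell_refine:
  assumes "a \<le> b" "0 < \<epsilon>" "0 < \<eta>" "0 \<le> R"
  obtains X' v' \<delta> where "finite X'" "0 < \<delta>" "nbhd (blind X' v') \<delta> \<subseteq> nbhd (seg x v) \<eta>"
    "cell x v a b \<subseteq> shadow (blind X' v')"
    "emeasure lborel (shadow (nbhd (blind X' v') \<delta>) \<inter> strip R - cell x v a b) \<le> ennreal \<epsilon>"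
proof -
  define S where "S = R + \<bar>a\<bar> + \<bar>b\<bar>"
  have S: "\<bar>a\<bar> \<le> S" "\<bar>b\<bar> \<le> S" "R \<le> S" "0 \<le> S" using assms(4) by (auto simp: S_def)
  \<comment> \<open>The crude bound: no slice over a parameter of modulus at most \<open>S\<close>
    is longer than \<open>M\<close>.\<close>
  define M where "M = 2 * (1 + S) * (norm v + 1)"
  have M: "0 < M" using S by (simp add: M_def add_nonneg_pos add_pos_nonneg)
  define \<epsilon>1 where "\<epsilon>1 = \<epsilon> / (3 * (2 * R + 1))"
  have \<epsilon>1: "0 < \<epsilon>1" "\<epsilon>1 * (2 * R) \<le> \<epsilon> / 3"
    using assms by (auto simp: \<epsilon>1_def divide_simps add_nonneg_pos)
  define \<tau> where "\<tau> = \<epsilon> / (6 * M)"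
  have \<tau>: "0 < \<tau>" "2 * (M * \<tau>) \<le> \<epsilon> / 3"
    using assms M by (auto simp: \<tau>_def)
  define d where "d = 6 * (1 + S) * (b - a + 1)"
  have d: "0 < d" using S assms(1) by (simp add: d_def)
  define \<eta>0 where "\<eta>0 = Min {\<eta>, 1, \<epsilon> / d}"
  have \<eta>0: "0 < \<eta>0" "\<eta>0 \<le> \<eta>" "\<eta>0 \<le> 1" "\<eta>0 \<le> \<epsilon> / d"
    using assms d by (auto simp: \<eta>0_def)
  \<comment> \<open>A point moved by at most \<open>\<eta>0\<close> has its projection moved by at
    most \<open>e\<close>; this is the width of the margins over \<open>[a, b]\<close>.\<close>
  define e where "e = (1 + S) * \<eta>0"
  have e0: "0 \<le> e" using S \<eta>0 by (simp add: e_def)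
  have "3 * (2 * e * (b - a)) \<le> 3 * (2 * e * (b - a + 1))" using e0 by (simp add: algebra_simps)
  also have "\<dots> = \<eta>0 * d" by (simp add: e_def d_def)
  also have "\<dots> \<le> \<epsilon>" using \<eta>0(4) d by (simp add: pos_le_divide_eq)
  finally have e: "2 * e * (b - a) \<le> \<epsilon> / 3" by simp
  have "finite {x}" by simp
  obtain X' v' \<delta> where X': "finite X'" "0 < \<delta>" "nbhd (blind X' v') \<delta> \<subseteq> nbhd (blind {x} v) \<eta>0"
    "\<And>\<alpha>. a \<le> \<alpha> \<Longrightarrow> \<alpha> \<le> b \<Longrightarrow> pr \<alpha> ` blind {x} v \<subseteq> pr \<alpha> ` blind X' v'"
    "\<And>\<alpha>. \<bar>\<alpha>\<bar> \<le> S \<Longrightarrow> \<alpha> \<le> a - \<tau> \<or> b + \<tau> \<le> \<alpha> \<Longrightarrow>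
      emeasure lborel (pr \<alpha> ` nbhd (blind X' v') \<delta>) \<le> ennreal \<epsilon>1"
    using two_sided_sweep[OF \<open>finite {x}\<close> \<tau>(1) \<epsilon>1(1) \<eta>0(1) S(1,2), of v] by metis
  define H where "H = nbhd (blind X' v') \<delta>"
  have "blind {x} v = seg x v" by (simp add: blind_def)
  note X' = X'[unfolded this, folded H_def]
  have H: "compact H" unfolding H_def by (intro compact_nbhd compact_blind X'(1))
  define T where "T = shadow H \<inter> strip R - cell x v a b"
  have T: "T \<in> sets borel"
    unfolding T_def
    by (intro sets.Diff sets.Int borel_closed closed_shadow[OF H] closed_strip closed_cell)
  \<comment> \<open>The summands belong to the swept parameters, the interval \<open>[a, b]\<close>
    and the two gaps, in this order.\<close>
  define g where "g \<alpha> = ennreal \<epsilon>1 * indicator {-R..R} \<alpha> + ennreal (2 * e) * indicator {a..b} \<alpha>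
      + ennreal M * indicator {a - \<tau>..a} \<alpha> + ennreal M * indicator {b..b + \<tau>} \<alpha>" for \<alpha>
  have g: "emeasure lborel (Pair \<alpha> -` T) \<le> g \<alpha>" for \<alpha>
  proof (cases "\<bar>\<alpha>\<bar> \<le> R")
    case False
    then have "Pair \<alpha> -` T = {}" by (auto simp: T_def strip_def)
    then show ?thesis by simp
  next
    case True
    then have \<alpha>S: "\<bar>\<alpha>\<bar> \<le> S" using S by linarith
    define c where "c = pr \<alpha> x"
    define r where "r = \<bar>pr \<alpha> v\<bar>"
    have sub: "Pair \<alpha> -` T \<subseteq> pr \<alpha> ` H" by (auto simp: T_def shadow_def)
    have "pr \<alpha> ` H \<subseteq> cball c (r + (1 + \<bar>\<alpha>\<bar>) * \<eta>0)"
      using X'(3) pr_nbhd_seg[of \<eta>0 \<alpha> x v] \<eta>0(1) unfolding c_def r_def by fastforce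
    also have "\<dots> \<subseteq> cball c (r + e)"
      unfolding e_def using \<alpha>S \<eta>0(1) by (intro subset_cball add_left_mono mult_right_mono) auto
    finally have ball: "pr \<alpha> ` H \<subseteq> cball c (r + e)" .
    have pH: "pr \<alpha> ` H \<in> sets lborel"
      using compact_continuous_image[OF continuous_on_pr H] by (simp add: borel_compact)
    consider "a \<le> \<alpha> \<and> \<alpha> \<le> b" | "\<alpha> \<le> a - \<tau> \<or> b + \<tau> \<le> \<alpha>" | "a - \<tau> \<le> \<alpha> \<and> \<alpha> \<le> a \<or> b \<le> \<alpha> \<and> \<alpha> \<le> b + \<tau>"
      by linarith
    then show ?thesis
    proof cases
      case 1
      then have "Pair \<alpha> -` T \<subseteq> cball c (r + e) - cball c r"
        using sub ball by (auto simp: T_def cell_def pr_seg c_def r_def)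
      then have "emeasure lborel (Pair \<alpha> -` T) \<le> emeasure lborel (cball c (r + e) - cball c r)"
        by (intro emeasure_mono) auto
      also have "\<dots> \<le> ennreal (2 * e)" by (intro emeasure_cball_Diff e0) (simp add: r_def)
      also have "\<dots> \<le> g \<alpha>" using 1 by (simp add: g_def add_increasing add_increasing2)
      finally show ?thesis .
    next
      case 2
      have "emeasure lborel (Pair \<alpha> -` T) \<le> emeasure lborel (pr \<alpha> ` H)"
        using sub pH by (rule emeasure_mono)
      also have "\<dots> \<le> ennreal \<epsilon>1" by (rule X'(5)[OF \<alpha>S 2])
      also have "\<dots> \<le> g \<alpha>" using True by (auto simp: g_def add_increasing2 abs_le_iff indicator_def)
      finally show ?thesis .
    next
      case 3
      have "emeasure lborel (Pair \<alpha> -` T) \<le> emeasure lborel (cball c (r + e))"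
        using sub ball by (intro emeasure_mono) auto
      also have "\<dots> = ennreal (2 * (r + e))"
        using e0 by (simp add: cball_eq_atLeastAtMost r_def)
      also have "\<dots> \<le> ennreal M"
      proof (rule ennreal_leI)
        have "r \<le> (1 + \<bar>\<alpha>\<bar>) * norm v" unfolding r_def by (rule abs_pr_le)
        also have "\<dots> \<le> (1 + S) * norm v" using \<alpha>S by (intro mult_right_mono) auto
        finally have "r \<le> (1 + S) * norm v" .
        moreover have "e \<le> (1 + S) * 1" unfolding e_def using S \<eta>0 by (intro mult_left_mono) auto
        ultimately show "2 * (r + e) \<le> M" by (simp add: M_def algebra_simps)
      qed
      also have "\<dots> \<le> g \<alpha>" using 3 by (auto simp: g_def add_increasing add_increasing2)
      finally show ?thesis .
    qed
  qed
  have "emeasure lborel T \<le> (\<integral>\<^sup>+ \<alpha>. g \<alpha> \<partial>lborel)"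
    unfolding emeasure_lborel_slices[OF T] by (intro nn_integral_mono g)
  also have "\<dots> = ennreal \<epsilon>1 * ennreal (2 * R) + ennreal (2 * e) * ennreal (b - a)
      + ennreal M * ennreal \<tau> + ennreal M * ennreal \<tau>"
    unfolding g_def using assms(1,4) \<tau>(1)
    by (simp add: nn_integral_add nn_integral_cmult_indicator)
  also have "\<dots> = ennreal (\<epsilon>1 * (2 * R) + 2 * e * (b - a) + M * \<tau> + M * \<tau>)"
  proof -
    have "0 \<le> \<epsilon>1" "0 \<le> 2 * R" "0 \<le> 2 * e" "0 \<le> b - a" "0 \<le> M" "0 \<le> \<tau>"
      using assms(1,4) \<epsilon>1(1) e0 M \<tau>(1) by auto
    then show ?thesis
      by (simp only: ennreal_plus ennreal_mult mult_nonneg_nonneg add_nonneg_nonneg)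
  qed
  also have "\<dots> \<le> ennreal \<epsilon>" using \<epsilon>1(2) e \<tau>(2) by (intro ennreal_leI) linarith
  finally have "emeasure lborel T \<le> ennreal \<epsilon>" .
  moreover have "cell x v a b \<subseteq> shadow (blind X' v')"
    using X'(4) unfolding cell_def shadow_def by auto
  moreover have "H \<subseteq> nbhd (seg x v) \<eta>"
    using X'(3) nbhd_mono[OF order_refl \<eta>0(2)] by (rule subset_trans)
  ultimately show ?thesis using that X'(1,2) unfolding T_def H_def by blast
qed

text \<open>Cutting the segment into \<open>M\<close> parts and the parameter line at the multiples
  of \<open>1 / M\<close> gives cells whose diameter is of order \<open>1 / M\<close> near the given
  point. The indices are natural numbers and integers, so only countably many cells are ever
  considered.\<close>

lemma small_cell:
  assumes "open G" "(\<alpha>, s) \<in> G" "s \<in> pr \<alpha> ` seg x v"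
  obtains M j i where "0 < M" "j < M"
    "(\<alpha>, s) \<in> cell (x + mid M j *\<^sub>R v) ((1 / real M) *\<^sub>R v) (real_of_int i / M) ((real_of_int i + 1) / M)"
    "cell (x + mid M j *\<^sub>R v) ((1 / real M) *\<^sub>R v) (real_of_int i / M) ((real_of_int i + 1) / M) \<subseteq> G"
proof -
  obtain \<rho> where \<rho>: "0 < \<rho>" "ball (\<alpha>, s) \<rho> \<subseteq> G" using assms(1,2) open_contains_ball by blast
  obtain t where t: "\<bar>t\<bar> \<le> 1" "s = pr \<alpha> (x + t *\<^sub>R v)" using assms(3) by (metis imageE mem_seg)
  define z where "z = x + t *\<^sub>R v"
  \<comment> \<open>The terms bound, up to the factor \<open>1 / M\<close>, the change of the
    parameter, the effect on \<open>s\<close> of moving the point by at most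
    \<open>2 * norm v / M\<close>, and the effect on \<open>s\<close> of changing the parameter at
    the fixed point \<open>z\<close>.\<close>
  define D where "D = 1 + (2 + \<bar>\<alpha>\<bar>) * (2 * norm v) + norm z"
  have D: "0 < D" unfolding D_def by (intro add_pos_nonneg) auto
  obtain M where M: "D / \<rho> < real M" using reals_Archimedean2 by blast
  have M0: "0 < M" using M D \<rho>(1) by (metis divide_pos_pos less_trans of_nat_0_less_iff)
  have DM: "D / M < \<rho>" using M M0 \<rho>(1) by (simp add: field_simps)
  obtain j where j: "j < M" "\<bar>t - mid M j\<bar> \<le> 1 / M" using mid_near[OF M0 t(1)] .
  define i where "i = \<lfloor>\<alpha> * M\<rfloor>"
  have i: "real_of_int i / M \<le> \<alpha>" "\<alpha> \<le> (real_of_int i + 1) / M"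
    unfolding i_def using M0 by (simp_all add: pos_divide_le_eq pos_le_divide_eq)
  let ?y = "x + mid M j *\<^sub>R v" and ?u = "(1 / real M) *\<^sub>R v"
  have z: "z = ?y + (t - mid M j) *\<^sub>R v" by (simp add: z_def algebra_simps)
  show ?thesis
  proof (rule that[OF M0 j(1), of i])
    have "z \<in> seg ?y ?u"
      unfolding mem_seg
    proof (intro exI conjI)
      show "\<bar>(t - mid M j) * M\<bar> \<le> 1"
        using j(2) M0 unfolding abs_mult by (simp add: pos_le_divide_eq)
      show "z = ?y + ((t - mid M j) * real M) *\<^sub>R ?u" using M0 by (simp add: z)
    qed
    then show "(\<alpha>, s) \<in> cell ?y ?u (real_of_int i / M) ((real_of_int i + 1) / M)"
      unfolding cell_def using i t(2) by (auto simp: z_def)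
    show "cell ?y ?u (real_of_int i / M) ((real_of_int i + 1) / M) \<subseteq> G"
    proof clarify
      fix \<alpha>' s' assume "(\<alpha>', s') \<in> cell ?y ?u (real_of_int i / M) ((real_of_int i + 1) / M)"
      then obtain z' where z': "real_of_int i / M \<le> \<alpha>'" "\<alpha>' \<le> (real_of_int i + 1) / M"
        "z' \<in> seg ?y ?u" "s' = pr \<alpha>' z'"
        unfolding cell_def by auto
      obtain t' where t': "\<bar>t'\<bar> \<le> 1" "z' = ?y + t' *\<^sub>R ?u" using z'(3) mem_seg by blast
      have "(real_of_int i + 1) / M = real_of_int i / M + 1 / M" by (simp add: add_divide_distrib)
      then have d\<alpha>: "\<bar>\<alpha>' - \<alpha>\<bar> \<le> 1 / M" using i z'(1,2) by linarith
      have "1 / real M \<le> 1" using M0 by simp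
      then have \<alpha>': "1 + \<bar>\<alpha>'\<bar> \<le> 2 + \<bar>\<alpha>\<bar>" using d\<alpha> by linarith
      have "z' - z = (t' / M - (t - mid M j)) *\<^sub>R v"
        unfolding z t'(2) by (simp add: algebra_simps)
      moreover have "\<bar>t' / M\<bar> \<le> 1 / M" using t'(1) M0 by (simp add: divide_right_mono)
      then have "\<bar>t' / M - (t - mid M j)\<bar> \<le> 2 / M" using j(2) by linarith
      ultimately have zz: "norm (z' - z) \<le> 2 * norm v / M"
        by (simp add: mult_right_mono[of _ "2 / real M" "norm v", simplified])
      have sz: "\<bar>snd z\<bar> \<le> norm z" using norm_snd_le[of "snd z" "fst z"] by simp
      have "s' - s = pr \<alpha>' (z' - z) - (\<alpha>' - \<alpha>) * snd z"
        unfolding z'(4) t(2) z_def[symmetric] pr_def by (simp add: algebra_simps)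
      then have "\<bar>s' - s\<bar> \<le> \<bar>pr \<alpha>' (z' - z)\<bar> + \<bar>\<alpha>' - \<alpha>\<bar> * \<bar>snd z\<bar>"
        unfolding abs_mult[symmetric] by linarith
      also have "\<dots> \<le> (2 + \<bar>\<alpha>\<bar>) * (2 * norm v / M) + (1 / M) * norm z"
      proof (intro add_mono mult_mono)
        have "\<bar>pr \<alpha>' (z' - z)\<bar> \<le> (1 + \<bar>\<alpha>'\<bar>) * norm (z' - z)" by (rule abs_pr_le)
        also have "\<dots> \<le> (2 + \<bar>\<alpha>\<bar>) * (2 * norm v / M)" using \<alpha>' zz by (intro mult_mono) auto
        finally show "\<bar>pr \<alpha>' (z' - z)\<bar> \<le> (2 + \<bar>\<alpha>\<bar>) * (2 * norm v / M)" .
      qed (use d\<alpha> sz in auto)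
      finally have "\<bar>\<alpha> - \<alpha>'\<bar> + \<bar>s - s'\<bar> \<le> D / M"
        using d\<alpha> unfolding D_def by (simp add: add_divide_distrib abs_minus_commute)
      moreover have "dist (\<alpha>, s) (\<alpha>', s') \<le> \<bar>\<alpha> - \<alpha>'\<bar> + \<bar>s - s'\<bar>"
        unfolding dist_Pair_Pair dist_real_def by (rule order_trans[OF sqrt_sum_squares_le_sum_abs]) simp
      ultimately show "(\<alpha>', s') \<in> G" using DM \<rho>(2) by force
    qed
  qed
qed

text \<open>The pairs \<open>(C, H)\<close> are the nodes of the tree of successive refinements: \<open>H\<close> meets every line
  dual to a point of \<open>C\<close>, and leaves room for further blinds.\<close>

definition good :: "(real \<times> real) set \<Rightarrow> (real \<times> real) set \<Rightarrow> bool" where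
  "good C H \<longleftrightarrow> compact H \<and>
    (\<exists>X v \<delta>. finite X \<and> 0 < \<delta> \<and> nbhd (blind X v) \<delta> \<subseteq> H \<and> C \<subseteq> shadow (blind X v))"

lemma good_subset_shadow: "good C H \<Longrightarrow> C \<subseteq> shadow H"
  unfolding good_def using shadow_mono subset_nbhd by (meson less_imp_le order_trans)

text \<open>All cells from the countable grid that fit into \<open>G\<close> are taken. Their
  segments are parts of the slats of the blind in \<open>H\<close>, so the room
  \<open>\<delta>\<close> around that blind serves each of them.\<close>

lemma good_split:
  assumes "good C H" "open G"
  obtains Q where "countable Q"
    "\<And>x v a b. (x, v, a, b) \<in> Q \<Longrightarrow> a \<le> b \<and> cell x v a b \<subseteq> G \<and> (\<exists>\<eta>>0. nbhd (seg x v) \<eta> \<subseteq> H)"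
    "\<And>p. p \<in> C \<Longrightarrow> p \<in> G \<Longrightarrow> \<exists>x v a b. (x, v, a, b) \<in> Q \<and> p \<in> cell x v a b"
proof -
  obtain X v \<delta> where X: "finite X" "0 < \<delta>" "nbhd (blind X v) \<delta> \<subseteq> H" "C \<subseteq> shadow (blind X v)"
    using assms(1) unfolding good_def by blast
  define f where "f = (\<lambda>(x, M, j, i). (x + mid M j *\<^sub>R v, (1 / real M) *\<^sub>R v,
      real_of_int i / M, (real_of_int i + 1) / M))"
  define I where "I = {(x, M, j, i). x \<in> X \<and> 0 < M \<and> j < M \<and>
      cell (x + mid M j *\<^sub>R v) ((1 / real M) *\<^sub>R v) (real_of_int i / M) ((real_of_int i + 1) / M) \<subseteq> G}"
  show ?thesis
  proof (rule that[of "f ` I"])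
    have "I \<subseteq> X \<times> UNIV" by (auto simp: I_def)
    moreover have "countable (X \<times> (UNIV :: (nat \<times> nat \<times> int) set))"
      using countable_finite[OF X(1)] by (intro countable_SIGMA) auto
    ultimately show "countable (f ` I)" by (meson countable_image countable_subset)
  next
    fix x' v' a b assume "(x', v', a, b) \<in> f ` I"
    then obtain x M j i where i: "x \<in> X" "0 < M" "j < M"
      "x' = x + mid M j *\<^sub>R v" "v' = (1 / real M) *\<^sub>R v"
      "a = real_of_int i / M" "b = (real_of_int i + 1) / M" "cell x' v' a b \<subseteq> G"
      by (auto simp: f_def I_def)
    have "seg x' v' \<subseteq> seg x v"
    proof
      fix z assume "z \<in> seg x' v'"
      then obtain t where t: "\<bar>t\<bar> \<le> 1" "z = x' + t *\<^sub>R v'" using mem_seg by blast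
      have "\<bar>t / M\<bar> \<le> 1 / M" using t(1) by (simp add: divide_right_mono)
      then have "\<bar>mid M j + t / M\<bar> \<le> 1" using abs_mid_le[OF i(3)] by linarith
      moreover have "z = x + (mid M j + t / M) *\<^sub>R v"
        unfolding t(2) i(4,5) by (simp add: algebra_simps)
      ultimately show "z \<in> seg x v" using mem_seg by blast
    qed
    then have "nbhd (seg x' v') \<delta> \<subseteq> nbhd (blind X v) \<delta>"
      using i(1) unfolding blind_def by (intro nbhd_mono) auto
    then show "a \<le> b \<and> cell x' v' a b \<subseteq> G \<and> (\<exists>\<eta>>0. nbhd (seg x' v') \<eta> \<subseteq> H)"
      using X(2,3) i by (auto simp: divide_right_mono)
  next
    fix p assume p: "p \<in> C" "p \<in> G"
    obtain \<alpha> s where ps: "p = (\<alpha>, s)" by (cases p)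
    obtain x where x: "x \<in> X" "s \<in> pr \<alpha> ` seg x v"
      using p(1) X(4) unfolding ps shadow_def blind_def by blast
    obtain M j i where M: "0 < M" "j < M"
      "(\<alpha>, s) \<in> cell (x + mid M j *\<^sub>R v) ((1 / real M) *\<^sub>R v) (real_of_int i / M) ((real_of_int i + 1) / M)"
      "cell (x + mid M j *\<^sub>R v) ((1 / real M) *\<^sub>R v) (real_of_int i / M) ((real_of_int i + 1) / M) \<subseteq> G"
      using small_cell[OF assms(2) p(2)[unfolded ps] x(2)] .
    have "(x, M, j, i) \<in> I" using x(1) M by (simp add: I_def)
    then have "(x + mid M j *\<^sub>R v, (1 / real M) *\<^sub>R v,
        real_of_int i / M, (real_of_int i + 1) / M) \<in> f ` I"
      by (rule rev_image_eqI) (simp add: f_def)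
    then show "\<exists>x v a b. (x, v, a, b) \<in> f ` I \<and> p \<in> cell x v a b"
      using M(3) unfolding ps by blast
  qed
qed

section \<open>Passing from one level of the tree to the next\<close>

lemma emeasure_countable_UN_le:
  assumes "countable I" "\<And>i. i \<in> I \<Longrightarrow> T i \<in> sets M" "0 < \<epsilon>"
    and "\<And>i. i \<in> I \<Longrightarrow> emeasure M (T i) \<le> ennreal (\<epsilon> * (1 / 2) ^ Suc (to_nat_on I i))"
  shows "emeasure M (\<Union>i\<in>I. T i) \<le> ennreal \<epsilon>"
proof -
  \<comment> \<open>Indices that are not hit by the enumeration get the empty set, so that finite
    and infinite \<open>I\<close> are treated alike.\<close>
  define f where "f n = (if n \<in> to_nat_on I ` I then T (from_nat_into I n) else {})" for n
  have f: "f (to_nat_on I i) = T i" if "i \<in> I" for i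
    using that assms(1) by (simp add: f_def)
  have fM: "f n \<in> sets M" for n
    using assms(1,2) by (auto simp: f_def)
  have le: "emeasure M (f n) \<le> ennreal (\<epsilon> * (1 / 2) ^ Suc n)" for n
  proof (cases "n \<in> to_nat_on I ` I")
    case True
    then show ?thesis using f assms(4) by auto
  qed (simp add: f_def)
  have "(\<Union>i\<in>I. T i) = (\<Union>n. f n)"
  proof
    show "(\<Union>i\<in>I. T i) \<subseteq> (\<Union>n. f n)" using f by blast
    show "(\<Union>n. f n) \<subseteq> (\<Union>i\<in>I. T i)" using assms(1) by (auto simp: f_def split: if_splits)
  qed
  also have "emeasure M (\<Union>n. f n) \<le> (\<Sum>n. emeasure M (f n))"
    using fM by (intro emeasure_subadditive_countably) auto
  also have "\<dots> \<le> (\<Sum>n. ennreal (\<epsilon> * (1 / 2) ^ Suc n))"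
    using le by (intro suminf_le) auto
  also have "\<dots> = ennreal \<epsilon>"
    using sums_mult[OF power_half_series, of \<epsilon>] assms(3) by (intro suminf_ennreal_eq) auto
  finally show ?thesis .
qed

text \<open>Every node is split into cells inside \<open>G\<close>, and each cell is refined with
  its own share of a geometric series. Since the cells lie in \<open>G\<close>, whatever leaves
  \<open>G\<close> belongs to the excess of some refinement.\<close>

lemma next_level:
  assumes "countable \<N>" "\<And>C H. (C, H) \<in> \<N> \<Longrightarrow> good C H" "open G" "0 < \<epsilon>" "0 \<le> R"
  obtains \<N>' where "countable \<N>'" "\<And>C H. (C, H) \<in> \<N>' \<Longrightarrow> good C H"
    "\<And>C H p. (C, H) \<in> \<N> \<Longrightarrow> p \<in> C \<Longrightarrow> p \<in> G \<Longrightarrow> \<exists>C' H'. (C', H') \<in> \<N>' \<and> p \<in> C' \<and> H' \<subseteq> H"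
    "emeasure lborel ((\<Union>(C, H)\<in>\<N>'. shadow H) \<inter> strip R - G) \<le> ennreal \<epsilon>"
proof -
  have "\<forall>N\<in>\<N>. \<exists>Q. countable Q \<and>
    (\<forall>x v a b. (x, v, a, b) \<in> Q \<longrightarrow> a \<le> b \<and> cell x v a b \<subseteq> G \<and> (\<exists>\<eta>>0. nbhd (seg x v) \<eta> \<subseteq> snd N)) \<and>
    (\<forall>p. p \<in> fst N \<longrightarrow> p \<in> G \<longrightarrow> (\<exists>x v a b. (x, v, a, b) \<in> Q \<and> p \<in> cell x v a b))"
  proof
    fix N assume "N \<in> \<N>"
    then have "good (fst N) (snd N)" using assms(2) by simp
    from good_split[OF this assms(3)] show "\<exists>Q. countable Q \<and>
      (\<forall>x v a b. (x, v, a, b) \<in> Q \<longrightarrow> a \<le> b \<and> cell x v a b \<subseteq> G \<and> (\<exists>\<eta>>0. nbhd (seg x v) \<eta> \<subseteq> snd N)) \<and>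
      (\<forall>p. p \<in> fst N \<longrightarrow> p \<in> G \<longrightarrow> (\<exists>x v a b. (x, v, a, b) \<in> Q \<and> p \<in> cell x v a b))"
      by metis
  qed
  from bchoice[OF this] obtain Q where Q: "\<And>N. N \<in> \<N> \<Longrightarrow> countable (Q N)"
    "\<And>N x v a b. N \<in> \<N> \<Longrightarrow> (x, v, a, b) \<in> Q N \<Longrightarrow>
      a \<le> b \<and> cell x v a b \<subseteq> G \<and> (\<exists>\<eta>>0. nbhd (seg x v) \<eta> \<subseteq> snd N)"
    "\<And>N p. N \<in> \<N> \<Longrightarrow> p \<in> fst N \<Longrightarrow> p \<in> G \<Longrightarrow> \<exists>x v a b. (x, v, a, b) \<in> Q N \<and> p \<in> cell x v a b"
    by metis
  \<comment> \<open>The parent node stays in the index: one cell may arise from several nodes, and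
    each needs a refinement inside its own \<open>H\<close>.\<close>
  define J where "J = Sigma \<N> Q"
  have J: "countable J" unfolding J_def by (intro countable_SIGMA assms(1) Q(1))
  define cl where "cl = (\<lambda>(N :: (real \<times> real) set \<times> (real \<times> real) set, x, v, a, b). cell x v a b)"
  have "\<forall>q\<in>J. \<exists>H'. good (cl q) H' \<and> H' \<subseteq> snd (fst q) \<and>
      emeasure lborel (shadow H' \<inter> strip R - cl q) \<le> ennreal (\<epsilon> * (1 / 2) ^ Suc (to_nat_on J q))"
  proof
    fix q assume "q \<in> J"
    then obtain N x v a b where q: "q = (N, x, v, a, b)" "N \<in> \<N>" "(x, v, a, b) \<in> Q N"
      by (auto simp: J_def)
    obtain \<eta> where \<eta>: "a \<le> b" "0 < \<eta>" "nbhd (seg x v) \<eta> \<subseteq> snd N" using Q(2)[OF q(2,3)] by blast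
    have "0 < \<epsilon> * (1 / 2) ^ Suc (to_nat_on J q)" using assms(4) by simp
    from cell_refine[OF \<eta>(1) this \<eta>(2) assms(5), of x v]
    obtain X' v' \<delta> where X': "finite X'" "0 < \<delta>" "nbhd (blind X' v') \<delta> \<subseteq> nbhd (seg x v) \<eta>"
      "cell x v a b \<subseteq> shadow (blind X' v')"
      "emeasure lborel (shadow (nbhd (blind X' v') \<delta>) \<inter> strip R - cell x v a b)
        \<le> ennreal (\<epsilon> * (1 / 2) ^ Suc (to_nat_on J q))"
      by metis
    have "good (cl q) (nbhd (blind X' v') \<delta>)"
      unfolding good_def q(1) cl_def prod.case
      using X'(1,2,4) compact_nbhd[OF compact_blind[OF X'(1)]] by blast
    then show "\<exists>H'. good (cl q) H' \<and> H' \<subseteq> snd (fst q) \<and>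
      emeasure lborel (shadow H' \<inter> strip R - cl q) \<le> ennreal (\<epsilon> * (1 / 2) ^ Suc (to_nat_on J q))"
      using X'(3,5) \<eta>(3) by (intro exI[of _ "nbhd (blind X' v') \<delta>"]) (auto simp: q(1) cl_def)
  qed
  from bchoice[OF this] obtain h where h: "\<And>q. q \<in> J \<Longrightarrow> good (cl q) (h q)"
    "\<And>q. q \<in> J \<Longrightarrow> h q \<subseteq> snd (fst q)"
    "\<And>q. q \<in> J \<Longrightarrow> emeasure lborel (shadow (h q) \<inter> strip R - cl q)
        \<le> ennreal (\<epsilon> * (1 / 2) ^ Suc (to_nat_on J q))"
    by metis
  define T where "T q = shadow (h q) \<inter> strip R - cl q" for q
  have T: "T q \<in> sets lborel" if "q \<in> J" for q
  proof -
    have "compact (h q)" using h(1)[OF that] by (simp add: good_def)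
    moreover have "closed (cl q)" by (cases q) (simp add: cl_def closed_cell)
    ultimately show ?thesis unfolding T_def sets_lborel
      by (intro sets.Diff sets.Int borel_closed closed_shadow closed_strip)
  qed
  show ?thesis
  proof (rule that[of "(\<lambda>q. (cl q, h q)) ` J"])
    show "countable ((\<lambda>q. (cl q, h q)) ` J)" using J by (rule countable_image)
    show "good C H" if "(C, H) \<in> (\<lambda>q. (cl q, h q)) ` J" for C H using that h(1) by auto
    show "\<exists>C' H'. (C', H') \<in> (\<lambda>q. (cl q, h q)) ` J \<and> p \<in> C' \<and> H' \<subseteq> H"
      if CH: "(C, H) \<in> \<N>" "p \<in> C" "p \<in> G" for C H p
    proof -
      obtain x v a b where *: "(x, v, a, b) \<in> Q (C, H)" "p \<in> cell x v a b"
        using Q(3)[OF CH(1), unfolded fst_conv, OF CH(2,3)] by blast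
      define q where "q = ((C, H), x, v, a, b)"
      have "q \<in> J" using CH(1) *(1) by (simp add: q_def J_def)
      moreover have "p \<in> cl q" "h q \<subseteq> H"
        using *(2) h(2)[OF \<open>q \<in> J\<close>] by (simp_all add: q_def cl_def)
      ultimately show ?thesis by blast
    qed
    have "cl q \<subseteq> G" if "q \<in> J" for q
      using that Q(2) by (fastforce simp: J_def cl_def)
    then have "(\<Union>(C, H)\<in>(\<lambda>q. (cl q, h q)) ` J. shadow H) \<inter> strip R - G \<subseteq> (\<Union>q\<in>J. T q)"
      unfolding T_def by fastforce
    moreover have "(\<Union>q\<in>J. T q) \<in> sets lborel" using J T by (intro sets.countable_UN') auto
    ultimately have "emeasure lborel ((\<Union>(C, H)\<in>(\<lambda>q. (cl q, h q)) ` J. shadow H) \<inter> strip R - G)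
        \<le> emeasure lborel (\<Union>q\<in>J. T q)"
      by (rule emeasure_mono)
    also have "\<dots> \<le> ennreal \<epsilon>"
      using h(3) by (intro emeasure_countable_UN_le J T assms(4)) (auto simp: T_def)
    finally show "emeasure lborel ((\<Union>(C, H)\<in>(\<lambda>q. (cl q, h q)) ` J. shadow H) \<inter> strip R - G)
        \<le> ennreal \<epsilon>" .
  qed
qed

text \<open>The points of \<open>H k\<close> projected to \<open>s\<close> by
  \<open>pr \<alpha>\<close> form decreasing nonempty compact sets, so some point is common to all
  of them.\<close>

lemma shadow_Inter_decreasing:
  assumes "\<And>k. compact (H k)" "\<And>k. H (Suc k) \<subseteq> H k" "\<And>k. (\<alpha>, s) \<in> shadow (H k)"
  shows "(\<alpha>, s) \<in> shadow (\<Inter>k. H k)"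
proof -
  define F where "F k = H k \<inter> {z. pr \<alpha> z = s}" for k
  have "closed {z. pr \<alpha> z = s}" by (intro closed_Collect_eq continuous_intros)
  then have "compact (F k)" for k unfolding F_def using assms(1) by (rule compact_Int_closed[rotated])
  moreover have "F k \<noteq> {}" for k using assms(3)[of k] unfolding F_def shadow_def by blast
  moreover have "F n \<subseteq> F m" if "m \<le> n" for m n
    using lift_Suc_antimono_le[of H, OF assms(2) that] unfolding F_def by blast
  ultimately have "\<Inter>(range F) \<noteq> {}" by (rule compact_nest)
  then show ?thesis unfolding F_def shadow_def by blast
qed

text \<open>The dual lines of the points at height \<open>c\<close> are the parallel lines of slope
  \<open>- c\<close>, which fill the plane. The horizontal line is cut into compact segments because
  \<open>V\<close> may become arbitrarily narrow along it.\<close>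

lemma root_level:
  assumes "open V" "{(u, c) | u. u \<in> UNIV} \<subseteq> V"
  obtains \<N> where "countable \<N>" "\<And>C H. (C, H) \<in> \<N> \<Longrightarrow> good C H \<and> H \<subseteq> V"
    "\<And>p. \<exists>C H. (C, H) \<in> \<N> \<and> p \<in> C"
proof -
  define S where "S j = seg (real_of_int j, c) (1, 0)" for j
  have S: "S j \<subseteq> V" for j
  proof
    fix z assume "z \<in> S j"
    then have "z = (fst z, c)" unfolding S_def mem_seg by auto
    then show "z \<in> V" using assms(2) by blast
  qed
  have "\<exists>\<delta>>0. nbhd (S j) \<delta> \<subseteq> V" for j
  proof -
    obtain \<delta> where \<delta>: "0 < \<delta>" "(\<Union>x\<in>S j. cball x \<delta>) \<subseteq> V"
      using compact_subset_open_imp_cball_epsilon_subset[OF _ assms(1) S]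
      by (metis S_def compact_seg)
    moreover have "nbhd (S j) \<delta> \<subseteq> (\<Union>x\<in>S j. cball x \<delta>)"
    proof
      fix z assume "z \<in> nbhd (S j) \<delta>"
      then obtain x y where "z = x + y" "x \<in> S j" "norm y \<le> \<delta>"
        unfolding nbhd_def mem_cball_0 by blast
      then have "x \<in> S j" "z \<in> cball x \<delta>" by (simp_all add: dist_norm)
      then show "z \<in> (\<Union>x\<in>S j. cball x \<delta>)" by blast
    qed
    ultimately show ?thesis by blast
  qed
  then obtain \<delta> where \<delta>: "\<And>j. 0 < \<delta> j" "\<And>j. nbhd (S j) (\<delta> j) \<subseteq> V" by metis
  show ?thesis
  proof (rule that[of "range (\<lambda>j. (shadow (S j), nbhd (S j) (\<delta> j)))"])
    show "good C H \<and> H \<subseteq> V" if "(C, H) \<in> range (\<lambda>j. (shadow (S j), nbhd (S j) (\<delta> j)))" for C H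
    proof -
      obtain j where j: "C = shadow (S j)" "H = nbhd (S j) (\<delta> j)" using \<open>(C, H) \<in> _\<close> by blast
      have b: "blind {(real_of_int j, c)} (1, 0) = S j" by (simp add: blind_def S_def)
      have "compact H" unfolding j S_def by (intro compact_nbhd compact_seg)
      then have "good C H"
        unfolding good_def using \<delta>(1) b j
        by (metis finite.emptyI finite.insertI order_refl)
      then show ?thesis using \<delta>(2) j by blast
    qed
    show "\<exists>C H. (C, H) \<in> range (\<lambda>j. (shadow (S j), nbhd (S j) (\<delta> j))) \<and> p \<in> C" for p
    proof -
      obtain \<alpha> s where p: "p = (\<alpha>, s)" by (cases p)
      define u where "u = s + \<alpha> * c"
      define j where "j = \<lfloor>u\<rfloor>"
      have "(u, c) \<in> S j"
        unfolding S_def mem_seg by (rule exI[of _ "u - j"]) (auto simp: j_def abs_le_iff, linarith+)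
      moreover have "s = pr \<alpha> (u, c)" by (simp add: pr_def u_def)
      ultimately have "p \<in> shadow (S j)" unfolding p shadow_def by blast
      then show ?thesis by blast
    qed
  qed auto
qed

section \<open>Linear projections\<close>

text \<open>Davies' theorem with slopes confined by \<open>V\<close>. Following one branch of the
  tree for each point of \<open>A\<close> gives covering, while the summable excesses of the levels
  make the remainder null.\<close>

theorem prescribed_projections:
  assumes "A \<in> sets (lebesgue :: (real \<times> real) measure)"
    and "open V" "{(u, c) | u. u \<in> UNIV} \<subseteq> V"
  obtains E where "E \<subseteq> V" "A \<subseteq> shadow E" "shadow E - A \<in> null_sets lebesgue"
proof -
  obtain B Z where B: "gdelta B" "Z \<in> null_sets lebesgue" "A \<union> Z = B"
    using lebesgue_set_almost_gdelta[OF assms(1)] by metis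
  obtain G0 :: "nat \<Rightarrow> (real \<times> real) set" where G0: "\<And>n. open (G0 n)" "B = (\<Inter>n. G0 n)"
    using B(1) by (auto elim: gdelta.cases)
  define G where "G k = (\<Inter>n\<le>k. G0 n)" for k
  have G: "open (G k)" "B \<subseteq> G k" "k \<le> l \<Longrightarrow> G l \<subseteq> G k" "G k \<subseteq> G0 k" for k l
    unfolding G_def using G0 by auto
  obtain \<N>0 where N0: "countable \<N>0" "\<And>C H. (C, H) \<in> \<N>0 \<Longrightarrow> good C H \<and> H \<subseteq> V"
    "\<And>p. \<exists>C H. (C, H) \<in> \<N>0 \<and> p \<in> C"
    using root_level[OF assms(2,3)] by metis
  \<comment> \<open>The clause for \<open>n = 0\<close> ties the sequence obtained by dependent
    choice to the root level, which yields both \<open>E \<subseteq> V\<close> and the starting node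
    of every branch.\<close>
  define P where "P n \<N> \<longleftrightarrow> countable \<N> \<and> (\<forall>C H. (C, H) \<in> \<N> \<longrightarrow> good C H) \<and> (n = 0 \<longrightarrow> \<N> = \<N>0)"
    for n :: nat and \<N>
  \<comment> \<open>The excess is controlled only over bounded parameters; the strip grows with the
    level and finally reaches each of them.\<close>
  define Q where "Q k \<N> \<N>' \<longleftrightarrow>
      (\<forall>C H p. (C, H) \<in> \<N> \<longrightarrow> p \<in> C \<longrightarrow> p \<in> G k \<longrightarrow> (\<exists>C' H'. (C', H') \<in> \<N>' \<and> p \<in> C' \<and> H' \<subseteq> H)) \<and>
      emeasure lborel ((\<Union>(C, H)\<in>\<N>'. shadow H) \<inter> strip (real k) - G k) \<le> ennreal ((1 / 2) ^ k)"
    for k :: nat and \<N> \<N>' :: "((real \<times> real) set \<times> (real \<times> real) set) set"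
  have "\<exists>N. \<forall>n. P n (N n) \<and> Q n (N n) (N (Suc n))"
  proof (rule dependent_nat_choice)
    show "\<exists>\<N>. P 0 \<N>" using N0(1,2) unfolding P_def by blast
    fix \<N> n assume "P n \<N>"
    then have *: "countable \<N>" "\<And>C H. (C, H) \<in> \<N> \<Longrightarrow> good C H" unfolding P_def by blast+
    have "(0::real) < (1 / 2) ^ n" "0 \<le> real n" by auto
    from next_level[OF * G(1) this] show "\<exists>\<N>'. P (Suc n) \<N>' \<and> Q n \<N> \<N>'"
      unfolding P_def Q_def by (metis nat.distinct(2))
  qed
  then obtain N where N: "\<And>n. P n (N n)" "\<And>n. Q n (N n) (N (Suc n))" by blast
  define E where "E = (\<Inter>k. \<Union>(C, H)\<in>N k. H)"
  have "A \<subseteq> shadow E"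
  proof
    fix p assume "p \<in> A"
    then have p: "p \<in> G k" for k using G(2) B(3) by blast
    \<comment> \<open>A branch of the tree whose nodes all carry \<open>p\<close>; at each level
      \<open>p \<in> G n\<close> allows the descent to a child.\<close>
    have "\<exists>f. \<forall>n. (f n \<in> N n \<and> p \<in> fst (f n)) \<and> snd (f (Suc n)) \<subseteq> snd (f n)"
    proof (rule dependent_nat_choice)
      show "\<exists>x. x \<in> N 0 \<and> p \<in> fst x" using N(1)[of 0] N0(3)[of p] unfolding P_def by force
      fix x n assume "x \<in> N n \<and> p \<in> fst x"
      then show "\<exists>y. (y \<in> N (Suc n) \<and> p \<in> fst y) \<and> snd y \<subseteq> snd x"
        using N(2)[of n] p[of n] unfolding Q_def by (cases x) fastforce
    qed
    then obtain f where f: "\<And>n. f n \<in> N n" "\<And>n. p \<in> fst (f n)" "\<And>n. snd (f (Suc n)) \<subseteq> snd (f n)"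
      by blast
    have good: "good (fst (f n)) (snd (f n))" for n
      using N(1)[of n] f(1)[of n] unfolding P_def by simp
    have "compact (snd (f n))" "p \<in> shadow (snd (f n))" for n
      using good[of n] good_subset_shadow[OF good[of n]] f(2)[of n] by (auto simp: good_def)
    then have "p \<in> shadow (\<Inter>k. snd (f k))"
      using shadow_Inter_decreasing[of "\<lambda>k. snd (f k)" "fst p" "snd p"] f(3) by simp
    moreover have "(\<Inter>k. snd (f k)) \<subseteq> E"
      unfolding E_def using f(1) by (force simp: case_prod_unfold)
    ultimately show "p \<in> shadow E" using shadow_mono by blast
  qed
  have "E \<subseteq> (\<Union>(C, H)\<in>N 0. H)" unfolding E_def by blast
  also have "\<dots> \<subseteq> V" using N(1)[of 0] N0(2) unfolding P_def by blast
  finally have "E \<subseteq> V" .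
  define T where "T k = (\<Union>(C, H)\<in>N (Suc k). shadow H) \<inter> strip (real k) - G k" for k
  have T: "T k \<in> sets lborel" for k
  proof -
    have "(\<Union>(C, H)\<in>N (Suc k). shadow H) \<in> sets borel"
      using N(1)[of "Suc k"] unfolding P_def good_def case_prod_unfold
      by (intro sets.countable_UN') (auto intro!: borel_closed closed_shadow)
    then show ?thesis
      unfolding T_def sets_lborel
      by (intro sets.Diff sets.Int borel_closed[OF closed_strip] borel_open[OF G(1)])
  qed
  have TE: "emeasure lborel (T k) \<le> ennreal ((1 / 2) ^ k)" for k
    using N(2)[of k] unfolding Q_def T_def by blast
  \<comment> \<open>A point of the shadow outside of \<open>B\<close> lies in \<open>T k\<close>
    only from some level on, depending on the point. Hence tails are intersected, and each tail is
    null as the bounds tend to 0.\<close>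
  define W where "W K = (\<Inter>k\<in>{K..}. T k)" for K
  have "W K \<in> null_sets lborel" for K
  proof (rule null_setsI)
    show W: "W K \<in> sets lborel" unfolding W_def using T by (intro sets.countable_INT') auto
    have "emeasure lborel (W K) \<le> ennreal ((1 / 2) ^ k)" if "K \<le> k" for k
    proof -
      have "emeasure lborel (W K) \<le> emeasure lborel (T k)"
        using that T by (intro emeasure_mono) (auto simp: W_def)
      then show ?thesis using TE order_trans by blast
    qed
    moreover have "(\<lambda>k. ennreal ((1 / 2) ^ k)) \<longlonglongrightarrow> ennreal 0"
      by (intro tendsto_ennrealI LIMSEQ_power_zero) simp
    ultimately have "emeasure lborel (W K) \<le> ennreal 0" using LIMSEQ_le_const by blast
    then show "emeasure lborel (W K) = 0" by simp
  qed
  then have "(\<Union>K. W K) \<in> null_sets lborel" by (intro null_sets_UN) auto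
  then have "(\<Union>K. W K) \<union> Z \<in> null_sets lebesgue"
    using null_sets.Un[OF null_sets_completionI B(2)] by blast
  moreover have "shadow E - A \<subseteq> (\<Union>K. W K) \<union> Z"
  proof
    fix p assume p: "p \<in> shadow E - A"
    show "p \<in> (\<Union>K. W K) \<union> Z"
    proof (cases "p \<in> Z")
      case False
      then have "p \<notin> B" using p B(3) by blast
      then obtain m where m: "p \<notin> G m" using G0(2) G(4) by blast
      obtain j :: nat where j: "\<bar>fst p\<bar> \<le> real j" using real_arch_simple by blast
      have "p \<in> T k" if "max m j \<le> k" for k
      proof -
        have "p \<notin> G k" using m G(3)[of m k] that by auto
        moreover have "p \<in> strip (real k)" using j that by (auto simp: strip_def case_prod_unfold)
        moreover have "p \<in> shadow (\<Union>(C, H)\<in>N (Suc k). H)"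
          using p shadow_mono[of E "\<Union>(C, H)\<in>N (Suc k). H"] unfolding E_def by blast
        then have "p \<in> (\<Union>(C, H)\<in>N (Suc k). shadow H)" by (fastforce simp: shadow_def)
        ultimately show ?thesis unfolding T_def by blast
      qed
      then have "p \<in> W (max m j)" unfolding W_def by blast
      then show ?thesis by blast
    qed simp
  qed
  ultimately have "shadow E - A \<in> null_sets lebesgue" by (rule null_sets_completion_subset[rotated])
  with \<open>E \<subseteq> V\<close> \<open>A \<subseteq> shadow E\<close> show ?thesis by (rule that)
qed

section \<open>From linear to radial projections\<close>

text \<open>Tonelli's theorem is applied to a Borel null set containing \<open>Z\<close>;
  completeness then settles the slices of \<open>Z\<close> itself.\<close>

lemma null_sets_lebesgue_slices:
  fixes Z :: "(real \<times> real) set"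
  assumes "Z \<in> null_sets lebesgue"
  shows "AE \<alpha> in lebesgue. Pair \<alpha> -` Z \<in> null_sets lebesgue"
proof -
  obtain Y where Y: "Y \<in> null_sets lborel" "Z \<subseteq> Y"
    using assms[unfolded null_sets_completion_iff2] by blast
  have Y_sets: "Y \<in> sets borel" using null_setsD2[OF Y(1)] by simp
  then have Y_prod: "Y \<in> sets (lborel \<Otimes>\<^sub>M lborel)" unfolding lborel_prod sets_lborel .
  have "(\<integral>\<^sup>+ \<alpha>. emeasure lborel (Pair \<alpha> -` Y) \<partial>lborel) = 0"
    using null_setsD1[OF Y(1)] unfolding emeasure_lborel_slices[OF Y_sets] .
  then have "AE \<alpha> in lborel. emeasure lborel (Pair \<alpha> -` Y) = 0"
    by (simp only: nn_integral_0_iff_AE[OF lborel.measurable_emeasure_Pair[OF Y_prod]])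
  then have "AE \<alpha> in lborel. Pair \<alpha> -` Z \<in> null_sets lebesgue"
  proof (rule AE_mp, intro AE_I2 impI)
    fix \<alpha> assume "emeasure lborel (Pair \<alpha> -` Y) = 0"
    then have "Pair \<alpha> -` Y \<in> null_sets lborel"
      using sets_Pair1[OF Y_prod] by (intro null_setsI)
    then show "Pair \<alpha> -` Z \<in> null_sets lebesgue"
      using Y(2) unfolding null_sets_completion_iff2 by blast
  qed
  then show ?thesis by (rule AE_completion)
qed

section \<open>Directions on the two open half-circles described by slopes\<close>

definition dirn :: "real \<Rightarrow> real \<Rightarrow> real \<times> real" where
  "dirn \<sigma> s = (s / sqrt (1 + s\<^sup>2), \<sigma> / sqrt (1 + s\<^sup>2))"

lemma sqrt_one_plus_square_pos: "0 < sqrt (1 + (s::real)\<^sup>2)"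
  by (simp add: add_pos_nonneg)

lemma norm_pair_sign:
  fixes s \<sigma> :: real
  assumes "\<sigma> = 1 \<or> \<sigma> = -1"
  shows "norm (s, \<sigma>) = sqrt (1 + s\<^sup>2)"
  using assms by (auto simp: norm_Pair add.commute[of "s\<^sup>2"])

lemma dirn_in_unit_circle:
  assumes "\<sigma> = 1 \<or> \<sigma> = -1"
  shows "dirn \<sigma> s \<in> unit_circle"
proof -
  have "dirn \<sigma> s = (s, \<sigma>) /\<^sub>R norm (s, \<sigma>)"
    using norm_pair_sign[OF assms] by (simp add: dirn_def divide_inverse)
  moreover have "(s, \<sigma>) \<noteq> 0" using assms by (auto simp: zero_prod_def)
  ultimately show ?thesis by (simp add: unit_circle_def del: scaleR_Pair)
qed

lemma dirn_of_unit_circle: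
  assumes "z \<in> unit_circle" "\<sigma> = 1 \<or> \<sigma> = -1" "0 < \<sigma> * snd z"
  shows "z = dirn \<sigma> (fst z / (\<sigma> * snd z))"
proof -
  obtain x y where z: "z = (x, y)" by (cases z)
  have xy: "x\<^sup>2 + y\<^sup>2 = 1" using assms(1) by (simp add: z unit_circle_def norm_Pair)
  have \<sigma>2: "(\<sigma> * y)\<^sup>2 = y\<^sup>2" "\<sigma> * \<sigma> = 1" using assms(2) by (auto simp: power_mult_distrib)
  have pos: "0 < \<sigma> * y" using assms(3) z by simp
  then have "y \<noteq> 0" by auto
  then have "1 + (x / (\<sigma> * y))\<^sup>2 = (1 / (\<sigma> * y))\<^sup>2"
    unfolding power_divide \<sigma>2(1) using xy by (simp add: field_simps)
  then have "sqrt (1 + (x / (\<sigma> * y))\<^sup>2) = 1 / (\<sigma> * y)"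
    using pos by (simp add: real_sqrt_abs)
  then show ?thesis using pos \<sigma>2(2) by (auto simp: z dirn_def algebra_simps)
qed

text \<open>With \<open>dirn_of_unit_circle\<close> this makes \<open>dirn \<sigma>\<close> a
  bijection from the line onto an open half-circle, upper or lower according to
  \<open>\<sigma>\<close>, with an explicit inverse.\<close>

lemma snd_dirn_pos:
  assumes "\<sigma> = 1 \<or> \<sigma> = -1"
  shows "0 < \<sigma> * snd (dirn \<sigma> s)" "fst (dirn \<sigma> s) / (\<sigma> * snd (dirn \<sigma> s)) = s"
proof -
  have "\<sigma> * \<sigma> = 1" using assms by auto
  then have "\<sigma> * snd (dirn \<sigma> s) = 1 / sqrt (1 + s\<^sup>2)" by (simp add: dirn_def)
  then show "0 < \<sigma> * snd (dirn \<sigma> s)" "fst (dirn \<sigma> s) / (\<sigma> * snd (dirn \<sigma> s)) = s"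
    using sqrt_one_plus_square_pos[of s] by (auto simp: dirn_def)
qed

text \<open>The vector from \<open>(\<alpha>, 0)\<close> is a positive multiple of
  \<open>(pr \<alpha> (u, v), \<sigma>)\<close>, and normalising removes the factor. This is where
  radial projections become linear.\<close>

lemma radial_point_eq_dirn:
  assumes "\<sigma> = 1 \<or> \<sigma> = -1" "0 < v"
  shows "radial_point (\<alpha>, 0) (u / v, \<sigma> / v) = dirn \<sigma> (pr \<alpha> (u, v))"
proof -
  let ?s = "pr \<alpha> (u, v)"
  have eq: "(u / v, \<sigma> / v) - (\<alpha>, 0) = (1 / v) *\<^sub>R (?s, \<sigma>)"
    using assms(2) by (simp add: pr_def field_simps)
  have "norm ((1 / v) *\<^sub>R (?s, \<sigma>)) = sqrt (1 + ?s\<^sup>2) / v"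
    unfolding norm_scaleR norm_pair_sign[OF assms(1)] using assms(2) by simp
  then show ?thesis
    unfolding radial_point_def eq using assms(2) by (simp add: dirn_def divide_inverse)
qed

section \<open>Angles as smooth functions of slopes\<close>

definition arccot :: "real \<Rightarrow> real" where
  "arccot s = pi / 2 - arctan s"

lemma arccot_bounds: "0 < arccot s" "arccot s < pi"
  unfolding arccot_def using arctan_bounded[of s] by auto

lemma cos_sin_arccot: "(cos (arccot s), sin (arccot s)) = dirn 1 s"
  by (simp add: arccot_def dirn_def cos_diff sin_diff sin_arctan cos_arctan)

lemma cos_sin_signed_arccot:
  assumes "\<sigma> = 1 \<or> \<sigma> = -1"
  shows "(cos (\<sigma> * arccot s), sin (\<sigma> * arccot s)) = dirn \<sigma> s"
  using assms cos_sin_arccot[of s] by (auto simp: dirn_def)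

lemma arccot_has_derivative:
  "(arccot has_real_derivative - inverse (1 + s\<^sup>2)) (at s within S)"
  unfolding arccot_def by (auto intro!: derivative_eq_intros)

lemma arccot_cot:
  assumes "0 < t" "t < pi"
  shows "arccot (cos t / sin t) = t"
proof -
  have "tan (pi / 2 - t) = cos t / sin t" by (simp add: tan_def sin_diff cos_diff)
  then have "arctan (cos t / sin t) = pi / 2 - t"
    using arctan_tan[of "pi / 2 - t"] assms by simp
  then show ?thesis by (simp add: arccot_def)
qed

text \<open>Arc length is parametrised over \<open>[0, 2 * pi)\<close>, so an angle in the lower
  half-circle appears as \<open>2 * pi - arccot s\<close> rather than
  \<open>- arccot s\<close>.\<close>

lemma circle_angle:
  assumes "0 \<le> t" "t < 2 * pi" "\<sigma> = 1 \<or> \<sigma> = -1" "0 < \<sigma> * sin t"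
  defines "s \<equiv> cos t / (\<sigma> * sin t)"
  shows "t = arccot s \<or> t = 2 * pi - arccot s"
proof (cases "\<sigma> = 1")
  case True
  then have "0 < sin t" using assms(4) by simp
  then have "t \<noteq> 0" "\<not> pi \<le> t" using assms(2) sin_le_zero[of t] by auto
  then have "0 < t" "t < pi" using assms(1) by auto
  then show ?thesis using arccot_cot[of t] True by (simp add: s_def)
next
  case False
  then have \<sigma>: "\<sigma> = -1" using assms(3) by blast
  then have "sin t < 0" using assms(4) by simp
  then have "pi < t" using assms(1) sin_ge_zero[of t] by linarith
  then have "arccot (cos (2 * pi - t) / sin (2 * pi - t)) = 2 * pi - t"
    using assms(2) by (intro arccot_cot) auto
  then show ?thesis by (simp add: s_def \<sigma>)
qed

text \<open>In the angle parameter the image lies in the images of a null set under two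
  differentiable functions, which preserve null sets.\<close>

lemma null_sets_dirn:
  assumes "S \<in> null_sets lebesgue" "\<sigma> = 1 \<or> \<sigma> = -1"
  shows "dirn \<sigma> ` S \<in> null_sets arc_length"
proof -
  obtain S' where S': "S' \<in> null_sets lborel" "S \<subseteq> S'"
    using assms(1)[unfolded null_sets_completion_iff2] by blast
  \<comment> \<open>A Borel set containing the image: it is described by the inverse of
    \<open>dirn \<sigma>\<close>, so its measurability does not depend on forming an image.\<close>
  define B where "B = unit_circle \<inter> {z. 0 < \<sigma> * snd z \<and> fst z / (\<sigma> * snd z) \<in> S'}"
  define g where "g t = (cos t, sin t)" for t :: real
  define L where "L = restrict_space lborel {0..<2 * pi}"
  define C where "C = restrict_space borel unit_circle"
  have S'_borel: "S' \<in> sets borel" using S'(1) by auto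
  have "{z. 0 < \<sigma> * snd z \<and> fst z / (\<sigma> * snd z) \<in> S'} \<in> sets (borel :: (real \<times> real) measure)"
  proof -
    have "(\<lambda>z :: real \<times> real. fst z / (\<sigma> * snd z)) \<in> borel_measurable borel"
      "(\<lambda>z :: real \<times> real. \<sigma> * snd z) \<in> borel_measurable borel"
      by (intro borel_measurable_divide borel_measurable_times borel_measurable_const
          borel_measurable_continuous_onI continuous_intros)+
    note [measurable] = this S'_borel
    have "Measurable.pred borel (\<lambda>z :: real \<times> real. 0 < \<sigma> * snd z \<and> fst z / (\<sigma> * snd z) \<in> S')"
      by measurable
    then show ?thesis by (simp add: pred_def)
  qed
  then have B: "B \<in> sets C" unfolding C_def B_def sets_restrict_space by blast
  have "g \<in> borel_measurable borel"
    unfolding g_def by (intro borel_measurable_continuous_onI continuous_intros)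
  moreover have "g \<in> space L \<rightarrow> unit_circle"
    by (auto simp: g_def unit_circle_def norm_Pair)
  ultimately have g: "g \<in> measurable L C"
    unfolding C_def L_def
    by (intro measurable_restrict_space2 measurable_restrict_space1) (simp_all add: L_def)
  have "g -` B \<inter> space L \<subseteq> arccot ` S' \<union> (\<lambda>s. 2 * pi - arccot s) ` S'"
  proof
    fix t assume "t \<in> g -` B \<inter> space L"
    then have t: "0 \<le> t" "t < 2 * pi" "0 < \<sigma> * sin t" "cos t / (\<sigma> * sin t) \<in> S'"
      by (auto simp: g_def B_def L_def space_restrict_space)
    show "t \<in> arccot ` S' \<union> (\<lambda>s. 2 * pi - arccot s) ` S'"
      using circle_angle[OF t(1,2) assms(2) t(3)] t(4) by blast
  qed
  moreover have "negligible (arccot ` S' \<union> (\<lambda>s. 2 * pi - arccot s) ` S')"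
  proof -
    have "negligible S'" using S'(1) by (simp add: negligible_iff_null_sets null_sets_completionI)
    moreover have arccot: "arccot differentiable_on S'"
      unfolding differentiable_on_def real_differentiable_def using arccot_has_derivative by blast
    moreover have "(\<lambda>s. 2 * pi - arccot s) differentiable_on S'"
      by (intro differentiable_on_diff arccot differentiable_on_const)
    ultimately show ?thesis
      by (intro negligible_Un negligible_differentiable_image_negligible) auto
  qed
  ultimately have "g -` B \<inter> space L \<in> null_sets lebesgue"
    using negligible_subset negligible_iff_null_sets by blast
  moreover have gB: "g -` B \<inter> space L \<in> sets L" using g B by (rule measurable_sets)
  then have "g -` B \<inter> space L \<in> sets lborel"
    unfolding L_def by (subst (asm) sets_restrict_space_iff) auto
  ultimately have "emeasure lborel (g -` B \<inter> space L) = 0"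
    using null_sets_completion_iff by blast
  then have "emeasure L (g -` B \<inter> space L) = 0"
    unfolding L_def by (subst emeasure_restrict_space) (auto simp: space_restrict_space)
  then have "B \<in> null_sets (distr L C g)"
    using B g by (intro null_setsI) (simp_all add: emeasure_distr)
  moreover have "dirn \<sigma> ` S \<subseteq> B"
    using S'(2) dirn_in_unit_circle[OF assms(2)] snd_dirn_pos[OF assms(2)] by (auto simp: B_def)
  ultimately show ?thesis
    unfolding arc_length_def null_sets_completion_iff2 L_def C_def g_def by blast
qed

text \<open>The set is a preimage under the continuous map \<open>\<phi>\<close>, and such preimages
  need not preserve Lebesgue measurability. The set is therefore split into a Borel part and a null
  part; the preimage of the latter is an image under the differentiable inverse
  \<open>\<psi>\<close>.\<close>

lemma slope_set_measurable:
  assumes "{(\<alpha>, t). (cos t, sin t) \<in> F \<alpha>} \<in> sets (lebesgue :: (real \<times> real) measure)"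
    and "\<sigma> = 1 \<or> \<sigma> = -1"
  shows "{(\<alpha>, s). dirn \<sigma> s \<in> F \<alpha>} \<in> sets (lebesgue :: (real \<times> real) measure)"
proof -
  define \<phi> where "\<phi> p = (fst p, \<sigma> * arccot (snd p))" for p :: "real \<times> real"
  define \<psi> where "\<psi> p = (fst p, \<sigma> * (cos (snd p) / sin (snd p)))" for p :: "real \<times> real"
  obtain C T where C: "fsigma C" "T \<in> null_sets lebesgue" "C \<union> T = {(\<alpha>, t). (cos t, sin t) \<in> F \<alpha>}"
    using lebesgue_set_almost_fsigma[OF assms(1)] by metis
  have "{(\<alpha>, s). dirn \<sigma> s \<in> F \<alpha>} = \<phi> -` (C \<union> T)"
    unfolding C(3) \<phi>_def using cos_sin_signed_arccot[OF assms(2)] by auto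
  also have "\<dots> = \<phi> -` C \<union> \<phi> -` T" by blast
  also have "\<dots> \<in> sets lebesgue"
  proof (rule sets.Un)
    have "C \<in> sets borel" using C(1) by (auto elim!: fsigma.cases)
    moreover have "\<phi> \<in> borel_measurable borel"
      unfolding \<phi>_def arccot_def by (intro borel_measurable_continuous_onI continuous_intros)
    ultimately show "\<phi> -` C \<in> sets lebesgue"
      using measurable_sets_borel[of \<phi> borel C] sets_completionI_sets[of "\<phi> -` C" lborel] by simp
    \<comment> \<open>This strip contains the range of \<open>\<phi>\<close> and avoids the zeros of
      the sine, so \<open>\<psi>\<close> is differentiable on it.\<close>
    define D where "D = T \<inter> {p. 0 < \<sigma> * snd p \<and> \<sigma> * snd p < pi}"
    have "\<psi> differentiable_on D"
      unfolding differentiable_on_def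
    proof
      fix p assume "p \<in> D"
      then have "0 < sin (\<sigma> * snd p)" by (auto simp: D_def intro: sin_gt_zero)
      then have "sin (snd p) \<noteq> 0" using assms(2) by auto
      then have "((\<lambda>t. \<sigma> * (cos t / sin t)) has_real_derivative
          \<sigma> * ((- sin (snd p) * sin (snd p) - cos (snd p) * cos (snd p)) / (sin (snd p) * sin (snd p))))
          (at (snd p))"
        by (intro DERIV_cmult DERIV_divide DERIV_cos DERIV_sin)
      then have "((\<lambda>p. (fst p, \<sigma> * (cos (snd p) / sin (snd p)))) has_derivative
          (\<lambda>h. (fst h, (\<sigma> * ((- sin (snd p) * sin (snd p) - cos (snd p) * cos (snd p))
            / (sin (snd p) * sin (snd p)))) * snd h))) (at p within D)"
        unfolding has_field_derivative_def
        by (intro has_derivative_Pair has_derivative_fst has_derivative_ident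
            has_derivative_compose[OF has_derivative_snd[OF has_derivative_ident]])
      then show "\<psi> differentiable at p within D"
        unfolding \<psi>_def differentiable_def by blast
    qed
    moreover have "negligible D"
      using C(2) unfolding D_def negligible_iff_null_sets by (rule null_sets_completion_subset[rotated]) blast
    ultimately have "negligible (\<psi> ` D)" by (intro negligible_differentiable_image_negligible) auto
    moreover have "\<phi> -` T \<subseteq> \<psi> ` D"
    proof
      fix p assume p: "p \<in> \<phi> -` T"
      have \<sigma>: "\<sigma> * \<sigma> = 1" using assms(2) by auto
      have "\<phi> p \<in> D"
        using p arccot_bounds[of "snd p"] \<sigma> by (simp add: D_def \<phi>_def flip: mult.assoc)
      moreover have "p = \<psi> (\<phi> p)"
      proof -
        have "\<sigma> * (fst (dirn \<sigma> (snd p)) / snd (dirn \<sigma> (snd p))) = snd p"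
          using snd_dirn_pos(2)[OF assms(2), of "snd p"] assms(2) by auto
        then show ?thesis
          by (simp add: \<phi>_def \<psi>_def prod_eq_iff flip: cos_sin_signed_arccot[OF assms(2)])
      qed
      ultimately show "p \<in> \<psi> ` D" by (rule rev_image_eqI)
    qed
    ultimately show "\<phi> -` T \<in> sets lebesgue"
      using negligible_subset negligible_imp_sets by blast
  qed
  finally show ?thesis .
qed

lemma half_plane:
  fixes F :: "real \<Rightarrow> (real \<times> real) set" and y :: real and U :: "(real \<times> real) set"
  assumes F: "\<And>\<alpha>. F \<alpha> \<subseteq> unit_circle"
    and meas: "{(\<alpha>, t). (cos t, sin t) \<in> F \<alpha>} \<in> sets (lebesgue :: (real \<times> real) measure)"
    and \<sigma>: "\<sigma> = 1 \<or> \<sigma> = -1" and y: "0 < \<sigma> * y"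
    and U: "open U" "{(x, y) | x. x \<in> UNIV} \<subseteq> U"
  obtains E where "E \<subseteq> U" "\<And>\<alpha>. F \<alpha> \<inter> {z. 0 < \<sigma> * snd z} \<subseteq> radial_proj (\<alpha>, 0) E"
    "AE \<alpha> in lebesgue. radial_proj (\<alpha>, 0) E - F \<alpha> \<in> null_sets arc_length"
proof -
  define A where "A = {(\<alpha>, s). dirn \<sigma> s \<in> F \<alpha>}"
  have A: "A \<in> sets lebesgue" unfolding A_def by (rule slope_set_measurable[OF meas \<sigma>])
  \<comment> \<open>The passage back from \<open>(u, v)\<close> to the plane, landing in the
    half-plane chosen by \<open>\<sigma>\<close>; \<open>V\<close> is what \<open>U\<close> looks
    like in these coordinates.\<close>
  define h where "h p = (fst p / snd p, \<sigma> / snd p)" for p :: "real \<times> real"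
  define V where "V = {p :: real \<times> real. 0 < snd p} \<inter> h -` U"
  have \<sigma>\<sigma>: "\<sigma> * \<sigma> = 1" using \<sigma> by auto
  have "open {p :: real \<times> real. 0 < snd p}" by (intro open_Collect_less continuous_intros)
  moreover have "continuous_on {p :: real \<times> real. 0 < snd p} h"
    unfolding h_def by (intro continuous_intros) auto
  ultimately have V: "open V"
    unfolding V_def using U(1) by (simp add: continuous_on_open_vimage Int_commute)
  \<comment> \<open>The horizontal line at height \<open>y\<close> becomes the line
    \<open>v = c\<close>.\<close>
  define c where "c = 1 / (\<sigma> * y)"
  have c: "0 < c" "\<sigma> / c = y" using y \<sigma>\<sigma> by (auto simp: c_def simp flip: mult.assoc)
  have "{(u, c) | u. u \<in> UNIV} \<subseteq> V" using U(2) c by (auto simp: V_def h_def)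
  then obtain E' where E': "E' \<subseteq> V" "A \<subseteq> shadow E'" "shadow E' - A \<in> null_sets lebesgue"
    using prescribed_projections[OF A V] by blast
  have proj: "radial_proj (\<alpha>, 0) (h ` E') = dirn \<sigma> ` (pr \<alpha> ` E')" for \<alpha>
  proof -
    \<comment> \<open>The second coordinate \<open>\<sigma> / v\<close> never vanishes, so removing
      the centre from the set removes nothing.\<close>
    have "(\<alpha>, 0) \<notin> h ` E'"
      using E'(1) \<sigma> by (force simp: V_def h_def)
    then have "radial_proj (\<alpha>, 0) (h ` E') = (\<lambda>p. radial_point (\<alpha>, 0) (h p)) ` E'"
      by (simp add: radial_proj_def image_image)
    also have "\<dots> = (\<lambda>p. dirn \<sigma> (pr \<alpha> p)) ` E'"
    proof (rule image_cong[OF refl])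
      fix p assume "p \<in> E'"
      then have "0 < snd p" using E'(1) by (auto simp: V_def)
      from radial_point_eq_dirn[OF \<sigma> this, of \<alpha> "fst p"]
      show "radial_point (\<alpha>, 0) (h p) = dirn \<sigma> (pr \<alpha> p)" by (simp add: h_def)
    qed
    finally show ?thesis by (simp add: image_image)
  qed
  show ?thesis
  proof (rule that[of "h ` E'"])
    show "h ` E' \<subseteq> U" using E'(1) by (auto simp: V_def)
    show "F \<alpha> \<inter> {z. 0 < \<sigma> * snd z} \<subseteq> radial_proj (\<alpha>, 0) (h ` E')" for \<alpha>
    proof
      fix z assume z: "z \<in> F \<alpha> \<inter> {z. 0 < \<sigma> * snd z}"
      define s where "s = fst z / (\<sigma> * snd z)"
      have zs: "z = dirn \<sigma> s"
        unfolding s_def using z F[of \<alpha>] by (intro dirn_of_unit_circle \<sigma>) auto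
      then have "(\<alpha>, s) \<in> shadow E'" using z E'(2) by (auto simp: A_def)
      then show "z \<in> radial_proj (\<alpha>, 0) (h ` E')" unfolding proj zs by (auto simp: shadow_def)
    qed
    have "AE \<alpha> in lebesgue. Pair \<alpha> -` (shadow E' - A) \<in> null_sets lebesgue"
      by (rule null_sets_lebesgue_slices[OF E'(3)])
    then show "AE \<alpha> in lebesgue. radial_proj (\<alpha>, 0) (h ` E') - F \<alpha> \<in> null_sets arc_length"
    proof (rule AE_mp, intro AE_I2 impI)
      fix \<alpha> assume "Pair \<alpha> -` (shadow E' - A) \<in> null_sets lebesgue"
      then have "dirn \<sigma> ` (Pair \<alpha> -` (shadow E' - A)) \<in> null_sets arc_length"
        using \<sigma> by (rule null_sets_dirn)
      moreover have "radial_proj (\<alpha>, 0) (h ` E') - F \<alpha> \<subseteq> dirn \<sigma> ` (Pair \<alpha> -` (shadow E' - A))"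
        unfolding proj by (auto simp: shadow_def A_def)
      ultimately show "radial_proj (\<alpha>, 0) (h ` E') - F \<alpha> \<in> null_sets arc_length"
        unfolding arc_length_def by (rule null_sets_completion_subset[rotated])
    qed
  qed
qed

theorem theorem5p9:
  fixes F :: "real \<Rightarrow> (real \<times> real) set" and ym yp :: real and U :: "(real \<times> real) set"
  assumes "\<And>\<alpha>. F \<alpha> \<subseteq> unit_circle"
    and "\<And>\<alpha>. (1, 0) \<notin> F \<alpha>"
    and "\<And>\<alpha>. (-1, 0) \<notin> F \<alpha>"
    and "{(\<alpha>, t). (cos t, sin t) \<in> F \<alpha>} \<in> sets (lebesgue :: (real \<times> real) measure)"
    and "ym < 0" and "0 < yp"
    and "open U"
    and "{(x, ym) | x. x \<in> UNIV} \<subseteq> U"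
    and "{(x, yp) | x. x \<in> UNIV} \<subseteq> U"
  shows "\<exists>E. E \<subseteq> U \<and>
    (AE \<alpha> in lebesgue.
      F \<alpha> \<subseteq> radial_proj (\<alpha>, 0) E \<and>
      radial_proj (\<alpha>, 0) E - F \<alpha> \<in> null_sets arc_length)"
proof -
  obtain E1 where E1: "E1 \<subseteq> U" "\<And>\<alpha>. F \<alpha> \<inter> {z. 0 < 1 * snd z} \<subseteq> radial_proj (\<alpha>, 0) E1"
    "AE \<alpha> in lebesgue. radial_proj (\<alpha>, 0) E1 - F \<alpha> \<in> null_sets arc_length"
    using half_plane[OF assms(1,4) _ _ assms(7,9), of 1] assms(6) by auto
  obtain E2 where E2: "E2 \<subseteq> U" "\<And>\<alpha>. F \<alpha> \<inter> {z. 0 < -1 * snd z} \<subseteq> radial_proj (\<alpha>, 0) E2"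
    "AE \<alpha> in lebesgue. radial_proj (\<alpha>, 0) E2 - F \<alpha> \<in> null_sets arc_length"
    using half_plane[OF assms(1,4) _ _ assms(7,8), of "-1"] assms(5) by auto
  have Un: "radial_proj (\<alpha>, 0) (E1 \<union> E2) = radial_proj (\<alpha>, 0) E1 \<union> radial_proj (\<alpha>, 0) E2" for \<alpha>
    unfolding radial_proj_def by blast
  have cover: "F \<alpha> \<subseteq> radial_proj (\<alpha>, 0) (E1 \<union> E2)" for \<alpha>
  proof
    fix z assume z: "z \<in> F \<alpha>"
    \<comment> \<open>The two excluded points of the circle are exactly those that neither
      half-plane can reach.\<close>
    have "snd z \<noteq> 0"
    proof
      assume "snd z = 0"
      then obtain x where x: "z = (x, 0)" by (metis prod.collapse)
      have "z \<in> unit_circle" using assms(1) z by blast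
      then have "\<bar>x\<bar> = 1" by (simp add: x unit_circle_def norm_Pair)
      then have "x = 1 \<or> x = -1" by linarith
      then show False using z x assms(2,3) by auto
    qed
    then show "z \<in> radial_proj (\<alpha>, 0) (E1 \<union> E2)"
      unfolding Un using E1(2)[of \<alpha>] E2(2)[of \<alpha>] z by (cases "0 < snd z") auto
  qed
  have "AE \<alpha> in lebesgue. radial_proj (\<alpha>, 0) (E1 \<union> E2) - F \<alpha> \<in> null_sets arc_length"
    using E1(3) E2(3)
  proof eventually_elim
    case (elim \<alpha>)
    then show ?case unfolding Un Un_Diff by (rule null_sets.Un)
  qed
  then show ?thesis using E1(1) E2(1) cover by (intro exI[of _ "E1 \<union> E2"]) auto
qed

end
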